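(* Let $H$ be a quasiparabolic subgroup of the finite Coxeter group $W$. Then $q^m\,\mathrm{PS}_{W/H}(q^{-1})=\mathrm{PS}_{W/H}(q)$, where $m=\max_{x\in W/H}\mathrm{ht}(x)$.
   Context: $(W,S)$ is a Coxeter system with length function $\ell$; $R(W)$ is the set of reflections, i.e. conjugates in $W$ of elements of $S$. A quasiparabolic $W$-set is a $W$-set $X$ with $\mathrm{ht}:X\to\mathbb Z$ satisfying $|\mathrm{ht}(sx)-\mathrm{ht}(x)|\le1$ for $s\in S$, $x\in X$, and: (QP1) for $r\in R(W)$, $x\in X$, if $\mathrm{ht}(rx)=\mathrm{ht}(x)$ then $rx=x$; (QP2) for $r\in R(W)$, $x\in X$, $s\in S$, if $\mathrm{ht}(rx)>\mathrm{ht}(x)$ and $\mathrm{ht}(srx)<\mathrm{ht}(sx)$, then $rx=sx$. A subgroup $H\subset W$ is quasiparabolic if $W/H$ (left cosets) with height $\mathrm{ht}(wH)=\min_{v\in wH}\ell(v)$ is a quasiparabolic $W$-set. The Poincaré series is $\mathrm{PS}_{W/H}(q)=\sum_{x\in W/H}q^{\mathrm{ht}(x)}$. *)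

theory Defs
  imports
    "HOL-Algebra.Multiplicative_Group"
    "HOL-Algebra.Generated_Groups"
    "HOL-Algebra.Group_Action"
    "HOL-Algebra.Left_Coset"
    "HOL-Computational_Algebra.Formal_Laurent_Series"
begin

definition word_prod :: "('a, 'b) monoid_scheme \<Rightarrow> 'a list \<Rightarrow> 'a" where
  "word_prod W ws = foldr (\<lambda>x y. x \<otimes>\<^bsub>W\<^esub> y) ws \<one>\<^bsub>W\<^esub>"

text \<open>
  Insertion of a relator \<open>(s t)\<^sup>m\<close> into a word over \<open>S\<close>, where \<open>m\<close> is the order of \<open>s t\<close> in \<open>W\<close>.
  The library's \<^const>\<open>group.ord\<close> is \<open>0\<close> for elements of infinite order, in which case the
  relator is the empty word, i.e. no relation is imposed on the pair.
\<close>

inductive relator_step :: "('a, 'b) monoid_scheme \<Rightarrow> 'a set \<Rightarrow> 'a list \<Rightarrow> 'a list \<Rightarrow> bool"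
  for W S where
  insert_relator:
    "\<lbrakk>u \<in> lists S; v \<in> lists S; s \<in> S; t \<in> S\<rbrakk> \<Longrightarrow>
      relator_step W S (u @ v)
        (u @ concat (replicate (group.ord W (s \<otimes>\<^bsub>W\<^esub> t)) [s, t]) @ v)"

text \<open>
  The last axiom says that \<open>W\<close> is presented by the generators \<open>S\<close> and the relations
  \<open>(s t)\<^bsup>m(s,t)\<^esup> = 1\<close>: two words with the same value are related by inserting and deleting relators.
  Formal inverses of generators are not needed in words, since the relator for \<open>s = t\<close>
  is \<open>[s, s]\<close>.
\<close>

locale coxeter_system = group W for W (structure) +
  fixes S
  assumes gens_closed: "S \<subseteq> carrier W"
    and generates: "generate W S = carrier W"
    and gens_involution: "s \<in> S \<Longrightarrow> s \<noteq> \<one> \<and> s \<otimes> s = \<one>"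
    and presentation:
      "\<lbrakk>u \<in> lists S; v \<in> lists S; word_prod W u = word_prod W v\<rbrakk> \<Longrightarrow>
        equivclp (relator_step W S) u v"
begin

definition len :: "'a \<Rightarrow> nat" where
  "len w = (LEAST n. \<exists>ws \<in> lists S. length ws = n \<and> word_prod W ws = w)"

definition reflections :: "'a set" where
  "reflections = {w \<otimes> s \<otimes> inv w | w s. w \<in> carrier W \<and> s \<in> S}"

definition coset_height :: "'a set \<Rightarrow> int" where
  "coset_height C = int (INF v\<in>C. len v)"

end

locale quasiparabolic_set = coxeter_system W S + group_action W X \<phi>
  for W :: "('a, 'b) monoid_scheme" (structure) and S and X :: "'x set" and \<phi> :: "'a \<Rightarrow> 'x \<Rightarrow> 'x" +
  fixes ht :: "'x \<Rightarrow> int"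
  assumes ht_step: "\<lbrakk>s \<in> S; x \<in> X\<rbrakk> \<Longrightarrow> \<bar>ht (\<phi> s x) - ht x\<bar> \<le> 1"
    and QP1: "\<lbrakk>r \<in> reflections; x \<in> X; ht (\<phi> r x) = ht x\<rbrakk> \<Longrightarrow> \<phi> r x = x"
    and QP2: "\<lbrakk>r \<in> reflections; x \<in> X; s \<in> S; ht (\<phi> r x) > ht x;
                ht (\<phi> s (\<phi> r x)) < ht (\<phi> s x)\<rbrakk> \<Longrightarrow> \<phi> r x = \<phi> s x"

text \<open>The library's actions consist of extensional functions, hence the restriction to the cosets.\<close>

definition coset_action :: "('a, 'b) monoid_scheme \<Rightarrow> 'a set \<Rightarrow> 'a \<Rightarrow> 'a set \<Rightarrow> 'a set" where
  "coset_action W H g = (\<lambda>C \<in> lcosets\<^bsub>W\<^esub> H. g <#\<^bsub>W\<^esub> C)"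

lemma (in group) lcosets_mult_closed:
  assumes "subgroup H G" "g \<in> carrier G" "C \<in> lcosets H"
  shows "g <# C \<in> lcosets H"
proof -
  obtain a where a: "a \<in> carrier G" "C = a <# H"
    using assms(3) by (auto simp: LCOSETS_def)
  then have "g <# C = (g \<otimes> a) <# H"
    using assms by (simp add: lcos_m_assoc subgroup.subset)
  then show ?thesis
    using a assms by (auto simp: LCOSETS_def)
qed

lemma (in group) group_action_coset_action:
  assumes H: "subgroup H G"
  shows "group_action G (lcosets H) (coset_action G H)"
proof -
  have sub: "C \<subseteq> carrier G" if "C \<in> lcosets H" for C
    using that H is_group subgroup.lcosets_carrier by blast
  have comp: "g <# (h <# C) = (g \<otimes> h) <# C"
    if "g \<in> carrier G" "h \<in> carrier G" "C \<in> lcosets H" for g h C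
    using that sub by (simp add: lcos_m_assoc)
  have one: "\<one> <# C = C" if "C \<in> lcosets H" for C
    using that sub by (simp add: lcos_mult_one)
  have bij: "coset_action G H g \<in> Bij (lcosets H)" if g: "g \<in> carrier G" for g
  proof -
    have "bij_betw (coset_action G H g) (lcosets H) (lcosets H)"
      by (rule bij_betw_byWitness[where f' = "coset_action G H (inv g)"])
        (use g in \<open>auto simp: coset_action_def lcosets_mult_closed[OF H] comp one\<close>)
    then show ?thesis
      by (simp add: Bij_def coset_action_def)
  qed
  have "coset_action G H (g \<otimes> h) = compose (lcosets H) (coset_action G H g) (coset_action G H h)"
    if "g \<in> carrier G" "h \<in> carrier G" for g h
    using that by (auto simp: coset_action_def compose_def fun_eq_iff comp lcosets_mult_closed[OF H])
  then have "coset_action G H \<in> hom G (BijGroup (lcosets H))"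
    using bij by (auto simp: hom_def BijGroup_def)
  then show ?thesis
    by (simp add: group_action_def group_hom_def group_hom_axioms_def group_BijGroup is_group)
qed

locale quasiparabolic_subgroup = coxeter_system W S for W (structure) and S +
  fixes H
  assumes subgroup_H: "subgroup H W"
    and quasiparabolic: "quasiparabolic_set W S (lcosets H) (coset_action W H) coset_height"

text \<open>
  The Poincare series of a finite set \<open>X\<close> (for infinite \<open>X\<close> the value is the junk value \<open>0\<close>),
  with \<open>q\<close> an invertible element of a field; with \<open>q =\<close> \<^term>\<open>fls_X\<close> or
  \<open>q =\<close> \<^term>\<open>inverse fls_X\<close> it is a formal Laurent polynomial.
\<close>

definition poincare_series :: "('x \<Rightarrow> int) \<Rightarrow> 'x set \<Rightarrow> 'k::field \<Rightarrow> 'k" where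
  "poincare_series ht X q = (\<Sum>x\<in>X. q powi ht x)"

end

theory Submission
  imports Defs "HOL-Computational_Algebra.Fundamental_Theorem_Algebra"
begin

text \<open>
  The Hecke algebra of \<open>W\<close> with parameter \<open>z\<close> acts on the functions on a quasiparabolic set \<open>X\<close>.
  Summing the action of all \<open>T\<^sub>w\<close> and evaluating at the minimal element gives a functional that
  takes the same value \<open>c\<close> on all point masses of a transitive \<open>X\<close>; applied to \<open>z\<^bsup>ht\<^esup>\<close> it yields
  \<open>PS\<^sub>W(z) = c PS\<^sub>X(z)\<close>.
  On the other hand the identity \<open>\<Sum>\<^sub>J (-1)\<^bsup>|J|\<^esup> PS\<^sub>W / PS\<^bsub>W\<^sub>J\<^esub> = q\<^sup>N\<close> shows, by induction on the rank,
  that all complex roots of \<open>PS\<^sub>W\<close> have modulus 1, hence so do the roots of \<open>PS\<^sub>X\<close>.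
  A real polynomial with all its roots on the unit circle that does not vanish at 1 equals its
  reversal.
\<close>

text \<open>A factor of a palindromic polynomial need not be palindromic, but it inherits the
  location of the roots; hence the detour through roots, which asks of \<open>c\<close> only that it
  exists. Divisibility is proved for each element \<open>z\<close> of a commutative ring, so a
  complex zero of PS_X is at once a zero of PS_W and no quotient polynomial is formed. The obstacle
  is that the operators T_w must be well defined on X. By Matsumoto's theorem this reduces to braid
  relations, hence to orbits of two generators. There QP1 and QP2 force the alternating paths from a
  lowest point to climb until they first meet, up to a fixed point at one end, and the two sides of
  a relation can be compared. The orbit may close up after k steps with k a proper divisor of the
  order m of s t, so the relation of length k has to be stretched to length m, and then carried from
  the lowest point to the rest of the orbit. Both are consequences of the quadratic relation of T_s.
  Lengths are compared by a single tool: the parity with which a reflection occurs in a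
  word.\<close>

section \<open>The exchange condition\<close>

text \<open>
  These rules would make \<open>auto\<close> replace membership in \<^term>\<open>lists S\<close> by a bounded quantifier, which
  blocks the simplification rules below.
\<close>

declare in_listsD [rule del] in_listsI [rule del]

lemma rev_in_lists_iff [simp]: "rev u \<in> lists A \<longleftrightarrow> u \<in> lists A"
  by (simp add: in_lists_conv_set)

context coxeter_system
begin

abbreviation wprod :: "'a list \<Rightarrow> 'a" where
  "wprod \<equiv> word_prod W"

lemma wprod_Nil [simp]: "wprod [] = \<one>"
  and wprod_Cons [simp]: "wprod (s # u) = s \<otimes> wprod u"
  by (simp_all add: word_prod_def)

lemma gen_closed [simp]: "s \<in> S \<Longrightarrow> s \<in> carrier W"
  using gens_closed by auto

lemma gen_square [simp]: "s \<in> S \<Longrightarrow> s \<otimes> s = \<one>"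
  using gens_involution by auto

lemma gen_inv [simp]: "s \<in> S \<Longrightarrow> inv s = s"
  by (simp add: inv_equality)

lemma gen_cancel [simp]: "s \<in> S \<Longrightarrow> x \<in> carrier W \<Longrightarrow> s \<otimes> (s \<otimes> x) = x"
  by (simp flip: m_assoc)

lemma wprod_closed [simp]: "u \<in> lists S \<Longrightarrow> wprod u \<in> carrier W"
  by (induction u) auto

lemma wprod_append: "u \<in> lists S \<Longrightarrow> v \<in> lists S \<Longrightarrow> wprod (u @ v) = wprod u \<otimes> wprod v"
  by (induction u) (auto simp: m_assoc)

lemma wprod_rev: "u \<in> lists S \<Longrightarrow> wprod (rev u) = inv (wprod u)"
  by (induction u) (auto simp: wprod_append inv_mult_group)

lemma word_exists:
  assumes "w \<in> carrier W"
  obtains u where "u \<in> lists S" "wprod u = w"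
proof -
  have "\<exists>u\<in>lists S. wprod u = w" if "w \<in> generate W S" for w
    using that
  proof induction
    case one
    then show ?case by (intro bexI[of _ "[]"]) auto
  next
    case (incl h)
    then show ?case by (intro bexI[of _ "[h]"]) auto
  next
    case (inv h)
    then show ?case by (intro bexI[of _ "[h]"]) auto
  next
    case (eng h1 h2)
    then obtain u v where "u \<in> lists S" "v \<in> lists S" "wprod u = h1" "wprod v = h2"
      by blast
    then show ?case by (intro bexI[of _ "u @ v"]) (auto simp: wprod_append)
  qed
  then show thesis using assms that generates by blast
qed

definition reduced :: "'a list \<Rightarrow> bool" where
  "reduced u \<longleftrightarrow> u \<in> lists S \<and> length u = len (wprod u)"

lemma reduced_lists: "reduced u \<Longrightarrow> u \<in> lists S"
  by (simp add: reduced_def)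

lemma len_le: "u \<in> lists S \<Longrightarrow> len (wprod u) \<le> length u"
  unfolding len_def by (rule Least_le) auto

lemma reduced_exists:
  assumes "w \<in> carrier W"
  obtains u where "reduced u" "wprod u = w"
proof -
  have "\<exists>n. \<exists>ws\<in>lists S. length ws = n \<and> wprod ws = w"
    using word_exists[OF assms] by blast
  from LeastI_ex[OF this] obtain u where "u \<in> lists S" "length u = len w" "wprod u = w"
    unfolding len_def by blast
  then show thesis using that by (auto simp: reduced_def)
qed

lemma len_one [simp]: "len \<one> = 0"
  using len_le[of "[]"] by simp

lemma len_eq_0: "w \<in> carrier W \<Longrightarrow> len w = 0 \<Longrightarrow> w = \<one>"
  by (metis length_0_conv reduced_def reduced_exists wprod_Nil)

lemma len_mult_le:
  assumes "v \<in> carrier W" "w \<in> carrier W"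
  shows "len (v \<otimes> w) \<le> len v + len w"
proof -
  obtain a b where "reduced a" "wprod a = v" "reduced b" "wprod b = w"
    using assms reduced_exists by metis
  then show ?thesis
    using len_le[of "a @ b"] by (auto simp: wprod_append reduced_def)
qed

lemma len_inv_le: "w \<in> carrier W \<Longrightarrow> len (inv w) \<le> len w"
  by (metis len_le length_rev reduced_def reduced_exists rev_in_lists_iff wprod_rev)

lemma len_inv [simp]: "w \<in> carrier W \<Longrightarrow> len (inv w) = len w"
  using len_inv_le[of w] len_inv_le[of "inv w"] by simp

lemma reduced_ConsD:
  assumes "reduced (s # u)"
  shows "reduced u"
proof -
  obtain v where v: "reduced v" "wprod v = wprod u"
    using assms reduced_exists[of "wprod u"] by (auto simp: reduced_def)
  have "len (wprod (s # v)) \<le> length (s # v)"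
    using assms v by (intro len_le) (auto simp: reduced_def)
  then show ?thesis
    using assms v len_le[of u] by (auto simp: reduced_def)
qed

section \<open>Parities of reflections and the strong exchange property\<close>

text \<open>
  Parity of the number of indices \<open>i\<close> with \<open>r = s\<^sub>1 \<cdots> s\<^sub>i \<cdots> s\<^sub>1\<close>. It is unchanged by inserting a relator,
  so it only depends on the value of the word.
\<close>

fun refl_parity :: "'a list \<Rightarrow> 'a \<Rightarrow> bool" where
  "refl_parity [] r \<longleftrightarrow> False"
| "refl_parity (s # u) r \<longleftrightarrow> ((r = s) \<noteq> refl_parity u (s \<otimes> r \<otimes> s))"

text \<open>The cocycle rule: reflections listed by the second word get conjugated by the value of
  the first. Later length comparisons split a concatenated word this way.\<close>

lemma refl_parity_append:
  assumes "u \<in> lists S" "v \<in> lists S" "r \<in> carrier W"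
  shows "refl_parity (u @ v) r \<longleftrightarrow>
    (refl_parity u r \<noteq> refl_parity v (inv (wprod u) \<otimes> r \<otimes> wprod u))"
  using assms
proof (induction u arbitrary: r)
  case (Cons s u)
  have "inv (wprod u) \<otimes> (s \<otimes> r \<otimes> s) \<otimes> wprod u = inv (wprod (s # u)) \<otimes> r \<otimes> wprod (s # u)"
    using Cons by (simp add: inv_mult_group m_assoc)
  then show ?case
    using Cons by auto
qed auto

text \<open>The repeated word lists the reflections
  \<open>(s \<otimes> t) [^] i \<otimes> s\<close>; peeling off one copy of \<open>[s, t]\<close>
  shifts the exponent by two.\<close>

lemma refl_parity_relator:
  assumes "s \<in> S" "t \<in> S" "r \<in> carrier W"
  shows "refl_parity (concat (replicate n [s, t])) r \<longleftrightarrow>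
    odd (\<Sum>i<2 * n. of_bool (r = (s \<otimes> t) [^] i \<otimes> s) :: nat)"
  using assms(3)
proof (induction n arbitrary: r)
  case (Suc n)
  let ?p = "s \<otimes> t"
  have p: "?p \<in> carrier W" using assms by simp
  have shift: "t \<otimes> (s \<otimes> r \<otimes> s) \<otimes> t = ?p [^] i \<otimes> s \<longleftrightarrow> r = ?p [^] (Suc (Suc i)) \<otimes> s" for i :: nat
  proof -
    have "?p [^] (Suc (Suc i)) \<otimes> s = ?p \<otimes> (?p [^] i \<otimes> s) \<otimes> (t \<otimes> s)"
    proof -
      have "?p [^] (Suc (Suc i)) \<otimes> s = ?p \<otimes> ?p [^] i \<otimes> ?p \<otimes> s"
        using p nat_pow_Suc2[OF p, of i] by simp
      then show ?thesis using assms p by (simp add: m_assoc)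
    qed
    moreover have "t \<otimes> (s \<otimes> r \<otimes> s) \<otimes> t = x \<longleftrightarrow> r = ?p \<otimes> x \<otimes> (t \<otimes> s)" if "x \<in> carrier W" for x
      using assms Suc.prems that by (auto simp: m_assoc)
    ultimately show ?thesis using p assms by simp
  qed
  have one: "s \<otimes> r \<otimes> s = t \<longleftrightarrow> r = ?p [^] Suc 0 \<otimes> s"
    using assms Suc.prems by (auto simp: m_assoc)
  have zero: "r = s \<longleftrightarrow> r = ?p [^] (0::nat) \<otimes> s"
    using assms by auto
  have IH: "refl_parity (concat (replicate n [s, t])) (t \<otimes> (s \<otimes> r \<otimes> s) \<otimes> t) \<longleftrightarrow>
    odd (\<Sum>i<2 * n. of_bool (r = ?p [^] (Suc (Suc i)) \<otimes> s) :: nat)"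
    using Suc.IH[of "t \<otimes> (s \<otimes> r \<otimes> s) \<otimes> t"] assms Suc.prems by (simp only: shift) simp
  have "(\<Sum>i<2 * Suc n. of_bool (r = ?p [^] i \<otimes> s) :: nat)
    = of_bool (r = ?p [^] (0::nat) \<otimes> s) + (of_bool (r = ?p [^] Suc 0 \<otimes> s)
      + (\<Sum>i<2 * n. of_bool (r = ?p [^] (Suc (Suc i)) \<otimes> s)))"
    by (simp only: mult_Suc_right add_2_eq_Suc sum.lessThan_Suc_shift)
  moreover have "refl_parity (concat (replicate (Suc n) [s, t])) r \<longleftrightarrow>
    ((r = s) \<noteq> ((t = s \<otimes> r \<otimes> s) \<noteq> refl_parity (concat (replicate n [s, t])) (t \<otimes> (s \<otimes> r \<otimes> s) \<otimes> t)))"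
    by auto
  ultimately show ?case
    unfolding IH using zero one by (auto simp: of_bool_def simp del: nat_pow_Suc)
qed auto

lemma relator_lists: "s \<in> S \<Longrightarrow> t \<in> S \<Longrightarrow> concat (replicate n [s, t]) \<in> lists S"
  by (induction n) auto

lemma wprod_relator:
  "s \<in> S \<Longrightarrow> t \<in> S \<Longrightarrow> wprod (concat (replicate n [s, t])) = (s \<otimes> t) [^] n"
proof (induction n)
  case (Suc n)
  then have "wprod (concat (replicate (Suc n) [s, t])) = (s \<otimes> t) \<otimes> (s \<otimes> t) [^] n"
    by (simp add: m_assoc)
  then show ?case using Suc by (simp only: nat_pow_Suc2 m_closed gen_closed)
qed simp

lemma refl_parity_relator_step:
  assumes "relator_step W S u v" "r \<in> carrier W"
  shows "refl_parity u r = refl_parity v r"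
  using assms(1)
proof cases
  case (insert_relator a b s t)
  let ?n = "ord (s \<otimes> t)"
  let ?R = "concat (replicate ?n [s, t])"
  have p: "(s \<otimes> t) [^] ?n = \<one>" using insert_relator by simp
  \<comment> \<open>As \<open>(s \<otimes> t) [^] ?n = \<one>\<close>, the list of
    \<open>2 * ?n\<close> reflections is a list of length \<open>?n\<close> repeated twice, so all
    counts are even. For infinite order \<open>?n = 0\<close> and the list is empty.\<close>
  have even: "\<not> refl_parity ?R x" if "x \<in> carrier W" for x
  proof -
    let ?f = "\<lambda>i. of_bool (x = (s \<otimes> t) [^] i \<otimes> s) :: nat"
    have "sum ?f {..<2 * ?n} = sum ?f {..<?n} + (\<Sum>i<?n. ?f (?n + i))"
      using sum.atLeastLessThan_concat[of 0 ?n "2 * ?n" ?f] sum.shift_bounds_nat_ivl[of ?f 0 ?n ?n]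
      by (simp add: lessThan_atLeast0 mult_2 add.commute)
    moreover have "(s \<otimes> t) [^] (?n + i) = (s \<otimes> t) [^] i" for i
      using insert_relator p by (simp flip: nat_pow_mult)
    ultimately show ?thesis
      using refl_parity_relator[of s t x ?n] insert_relator that by simp
  qed
  show ?thesis
    using insert_relator assms(2) even p relator_lists[of s t ?n]
    by (simp add: refl_parity_append wprod_append wprod_relator)
qed

lemma refl_parity_cong:
  assumes "u \<in> lists S" "v \<in> lists S" "wprod u = wprod v" "r \<in> carrier W"
  shows "refl_parity u r = refl_parity v r"
  using presentation[OF assms(1-3)]
proof (induction rule: equivclp_induct)
  case (step y z)
  then show ?case using refl_parity_relator_step assms(4) by metis
qed simp

text \<open>An odd count is positive, so \<open>r\<close> is one of the listed reflections
  \<open>s\<^sub>1 ... s\<^sub>i ... s\<^sub>1\<close>, and multiplying by it deletes the letter at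
  position \<open>i\<close>.\<close>

lemma refl_parity_deletion:
  assumes "u \<in> lists S" "r \<in> carrier W" "refl_parity u r"
  obtains a x b where "u = a @ x # b" "r \<otimes> wprod u = wprod (a @ b)"
proof -
  have "\<exists>a x b. u = a @ x # b \<and> r \<otimes> wprod u = wprod (a @ b)"
    using assms
  proof (induction u arbitrary: r)
    case (Cons s u)
    show ?case
    proof (cases "r = s")
      case True
      then show ?thesis using Cons.hyps by (intro exI[of _ "[]"]) auto
    next
      case False
      then obtain a x b where ab: "u = a @ x # b" "s \<otimes> r \<otimes> s \<otimes> wprod u = wprod (a @ b)"
        using Cons.IH[of "s \<otimes> r \<otimes> s"] Cons.hyps Cons.prems by auto
      have "r \<otimes> wprod (s # u) = s \<otimes> (s \<otimes> r \<otimes> s \<otimes> wprod u)"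
        using Cons.hyps Cons.prems by (simp add: m_assoc)
      then have "r \<otimes> wprod (s # u) = wprod ((s # a) @ b)"
        using ab by simp
      then show ?thesis using ab by (intro exI[of _ "s # a"]) auto
    qed
  qed auto
  then show thesis using that by blast
qed

lemma refl_parity_len_less:
  assumes "u \<in> lists S" "r \<in> carrier W" "refl_parity u r"
  shows "len (r \<otimes> wprod u) < len (wprod u)"
proof -
  obtain v where v: "reduced v" "wprod v = wprod u"
    using reduced_exists[of "wprod u"] assms by auto
  then have "refl_parity v r"
    using assms refl_parity_cong[of u v r] by (auto simp: reduced_def)
  then obtain a x b where "v = a @ x # b" "r \<otimes> wprod v = wprod (a @ b)"
    using refl_parity_deletion v assms by (metis reduced_lists)
  then show ?thesis
    using v len_le[of "a @ b"] by (auto simp: reduced_def)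
qed

text \<open>Prefixing \<open>s\<close> flips the parity at \<open>s\<close>, so exactly one of
  \<open>u\<close> and \<open>s # u\<close> has odd parity there, and its value is the longer one.
  In particular the two lengths differ.\<close>

lemma gen_parity_cases:
  assumes "s \<in> S" "u \<in> lists S"
  shows "refl_parity u s \<longleftrightarrow> len (s \<otimes> wprod u) < len (wprod u)"
    and "\<not> refl_parity u s \<longleftrightarrow> len (wprod u) < len (s \<otimes> wprod u)"
proof -
  have "len (wprod u) < len (s \<otimes> wprod u)" if "\<not> refl_parity u s"
    using refl_parity_len_less[of "s # u" s] that assms by simp
  with refl_parity_len_less[of u s] assms
  show "refl_parity u s \<longleftrightarrow> len (s \<otimes> wprod u) < len (wprod u)"
    and "\<not> refl_parity u s \<longleftrightarrow> len (wprod u) < len (s \<otimes> wprod u)"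
    by fastforce+
qed

lemma len_gen_mult:
  assumes "s \<in> S" "w \<in> carrier W"
  shows "len (s \<otimes> w) = Suc (len w) \<or> len w = Suc (len (s \<otimes> w))"
proof -
  have "len s \<le> 1" using len_le[of "[s]"] assms by simp
  then have "len (s \<otimes> w) \<le> Suc (len w)" "len w \<le> Suc (len (s \<otimes> w))"
    using len_mult_le[of s w] len_mult_le[of s "s \<otimes> w"] assms by auto
  moreover have "len (s \<otimes> w) \<noteq> len w"
    using gen_parity_cases[OF assms(1)] assms(2) word_exists by (metis less_irrefl)
  ultimately show ?thesis by linarith
qed

lemma reduced_ConsI:
  "reduced u \<Longrightarrow> s \<in> S \<Longrightarrow> len (wprod u) < len (s \<otimes> wprod u) \<Longrightarrow> reduced (s # u)"
  using len_gen_mult[of s "wprod u"] by (auto simp: reduced_def)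

lemma len_mult_gen:
  assumes "s \<in> S" "w \<in> carrier W"
  shows "len (w \<otimes> s) = Suc (len w) \<or> len w = Suc (len (w \<otimes> s))"
  using len_gen_mult[of s "inv w"] len_inv[of "w \<otimes> s"] assms by (simp add: inv_mult_group)

end

section \<open>Matsumoto's theorem\<close>

primrec alternating :: "nat \<Rightarrow> 'a \<Rightarrow> 'a \<Rightarrow> 'a list" where
  "alternating 0 s t = []"
| "alternating (Suc n) s t = s # alternating n t s"

lemma length_alternating [simp]: "length (alternating n s t) = n"
  by (induction n arbitrary: s t) auto

lemma alternating_snoc:
  "alternating (Suc n) s t = alternating n s t @ [if even n then s else t]"
  by (induction n arbitrary: s t) auto

lemma alternating_add:
  "alternating (m + n) s t =
    alternating m s t @ (if even m then alternating n s t else alternating n t s)"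
  by (induction m arbitrary: s t) auto

lemma alternating_in_lists [simp]: "s \<in> A \<Longrightarrow> t \<in> A \<Longrightarrow> alternating n s t \<in> lists A"
  by (induction n arbitrary: s t) auto

lemma (in group) pow_mult_swap:
  "s \<in> carrier G \<Longrightarrow> t \<in> carrier G \<Longrightarrow> s \<otimes> (t \<otimes> s) [^] (i::nat) = (s \<otimes> t) [^] i \<otimes> s"
proof (induction i)
  case (Suc i)
  have "s \<otimes> (t \<otimes> s) [^] Suc i = (s \<otimes> (t \<otimes> s) [^] i) \<otimes> (t \<otimes> s)"
    using Suc.prems by (simp flip: m_assoc)
  also have "\<dots> = (s \<otimes> t) [^] Suc i \<otimes> s"
    unfolding Suc.IH[OF Suc.prems] using Suc.prems by (simp add: m_assoc)
  finally show ?case .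
qed simp

context coxeter_system
begin

lemma refl_parity_alternating:
  assumes "s \<in> S" "t \<in> S" "r \<in> carrier W" "refl_parity (alternating j s t) r"
  shows "\<exists>i<j. r = (s \<otimes> t) [^] i \<otimes> s"
  using assms
proof (induction j arbitrary: s t r)
  case (Suc j)
  show ?case
  proof (cases "r = s")
    case True
    then show ?thesis using Suc.prems by (intro exI[of _ 0]) auto
  next
    case False
    then obtain i where i: "i < j" "s \<otimes> r \<otimes> s = (t \<otimes> s) [^] i \<otimes> t"
      using Suc.IH[of t s "s \<otimes> r \<otimes> s"] Suc.prems by auto
    have "r = s \<otimes> (s \<otimes> r \<otimes> s) \<otimes> s"
      using Suc.prems by (simp add: m_assoc)
    also have "\<dots> = s \<otimes> (t \<otimes> s) [^] i \<otimes> t \<otimes> s"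
      unfolding i using Suc.prems by (simp add: m_assoc)
    also have "\<dots> = (s \<otimes> t) [^] Suc i \<otimes> s"
      using Suc.prems by (simp add: pow_mult_swap m_assoc)
    finally show ?thesis using i by blast
  qed
qed auto

text \<open>Exchange for the descent \<open>t\<close> deletes a letter. It cannot lie in the
  alternating prefix, since \<open>t = (s \<otimes> t) [^] i \<otimes> s\<close> with
  \<open>i < j\<close> would bound the order of \<open>s \<otimes> t\<close> by \<open>j\<close>. So
  it lies in \<open>c\<close>, and the prefix grows by a \<open>t\<close> in front.\<close>

lemma alternating_exchange:
  assumes st: "s \<in> S" "t \<in> S" and j: "j < ord (s \<otimes> t)"
    and red: "reduced (alternating j s t @ c)"
    and desc: "len (t \<otimes> wprod (alternating j s t @ c)) < len (wprod (alternating j s t @ c))"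
  shows "\<exists>c'. reduced (alternating (Suc j) t s @ c') \<and>
    wprod (alternating (Suc j) t s @ c') = wprod (alternating j s t @ c)"
proof -
  let ?A = "alternating j s t"
  define g where "g = inv (wprod ?A) \<otimes> t \<otimes> wprod ?A"
  have c: "c \<in> lists S" using red by (auto simp: reduced_def)
  have g: "g \<in> carrier W" using st by (simp add: g_def)
  have cancel: "wprod ?A \<otimes> (inv (wprod ?A) \<otimes> y) = y" if "y \<in> carrier W" for y
    using st that by (simp flip: m_assoc)
  have "\<not> refl_parity ?A t"
  proof
    assume "refl_parity ?A t"
    with st have "\<exists>i<j. t = (s \<otimes> t) [^] i \<otimes> s"
      by (intro refl_parity_alternating) simp_all
    then obtain i where i: "i < j" "t = (s \<otimes> t) [^] i \<otimes> s"
      by blast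
    have "(s \<otimes> t) [^] Suc i = (s \<otimes> t) [^] i \<otimes> s \<otimes> t"
      using st by (simp add: m_assoc)
    also have "\<dots> = \<one>" using i(2)[symmetric] st by simp
    finally have "ord (s \<otimes> t) dvd Suc i"
      using pow_eq_id[of "s \<otimes> t" "Suc i"] st by (metis gen_closed m_closed)
    then show False using i j by (auto dest: dvd_imp_le)
  qed
  moreover have "refl_parity (?A @ c) t"
    using gen_parity_cases(1)[of t "?A @ c"] st c desc by simp
  ultimately have "refl_parity c g"
    using st c by (simp add: refl_parity_append g_def)
  then obtain p x q where pq: "c = p @ x # q" "g \<otimes> wprod c = wprod (p @ q)"
    using refl_parity_deletion[of c g] c g by blast
  have pql: "p @ q \<in> lists S" using pq c by auto
  have "wprod (alternating (Suc j) t s @ (p @ q)) = t \<otimes> (wprod ?A \<otimes> wprod (p @ q))"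
    using st pql by (simp add: wprod_append)
  also have "\<dots> = t \<otimes> (wprod ?A \<otimes> (g \<otimes> wprod c))"
    by (simp only: pq(2))
  also have "wprod ?A \<otimes> (g \<otimes> wprod c) = t \<otimes> (wprod ?A \<otimes> wprod c)"
    using st c cancel by (simp add: g_def m_assoc)
  finally have eq: "wprod (alternating (Suc j) t s @ (p @ q)) = wprod (?A @ c)"
    using st c by (simp add: wprod_append)
  moreover have "reduced (alternating (Suc j) t s @ (p @ q))"
    using red eq pq pql st by (simp add: reduced_def)
  ultimately show ?thesis by blast
qed

lemma wprod_alternating_swap:
  assumes "s \<in> S" "t \<in> S"
  shows "wprod (alternating j s t) = (s \<otimes> t) [^] j \<otimes> wprod (alternating j t s)"
  using assms
proof (induction j arbitrary: s t)
  case (Suc j)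
  have "(s \<otimes> t) [^] Suc j \<otimes> wprod (alternating (Suc j) t s)
    = (s \<otimes> t) [^] j \<otimes> s \<otimes> wprod (alternating j s t)"
    using Suc.prems by (simp add: m_assoc)
  also have "\<dots> = s \<otimes> ((t \<otimes> s) [^] j \<otimes> wprod (alternating j s t))"
    using Suc.prems by (simp add: m_assoc flip: pow_mult_swap)
  also have "\<dots> = wprod (alternating (Suc j) s t)"
    using Suc.IH[of t s] Suc.prems by simp
  finally show ?case by simp
qed simp

text \<open>\<open>P\<close> stays abstract so that it can later be equality of the operators given
  by two words. If the first letters differ, both are left descents of the common value, which then
  has reduced words starting with either alternating word of full length; these link
  \<open>a\<close> to \<open>b\<close>.\<close>

theorem matsumoto:
  assumes fin: "finite (carrier W)"
    and sym: "\<And>u v. P u v \<Longrightarrow> P v u"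
    and trans: "\<And>u v w. P u v \<Longrightarrow> P v w \<Longrightarrow> P u w"
    and Nil: "P [] []"
    and Cons: "\<And>s u v. s \<in> S \<Longrightarrow> P u v \<Longrightarrow> P (s # u) (s # v)"
    and braid: "\<And>s t u. s \<in> S \<Longrightarrow> t \<in> S \<Longrightarrow> s \<noteq> t \<Longrightarrow> u \<in> lists S \<Longrightarrow>
      P (alternating (ord (s \<otimes> t)) s t @ u) (alternating (ord (s \<otimes> t)) t s @ u)"
    and "reduced a" "reduced b" "wprod a = wprod b"
  shows "P a b"
  using assms(7-)
proof (induction "length a" arbitrary: a b rule: less_induct)
  case less
  have len: "length a = length b"
    using less.prems by (simp add: reduced_def)
  have same_head: "P (s # u) (s # v)"
    if "reduced (s # u)" "reduced (s # v)" "wprod (s # u) = wprod (s # v)" "length (s # u) = length a"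
    for s u v
  proof -
    have "s \<in> S" "u \<in> lists S" "v \<in> lists S"
      using that by (auto simp: reduced_def)
    moreover have "wprod u = wprod v"
      using that(3) calculation by simp
    ultimately show ?thesis
      using that less.hyps[of u v] by (auto dest: reduced_ConsD intro!: Cons)
  qed
  show ?case
  proof (cases a)
    case Nil
    then show ?thesis using len assms(4) by simp
  next
    case a: (Cons s a')
    then obtain t b' where b: "b = t # b'"
      using len by (cases b) auto
    have st: "s \<in> S" "t \<in> S" and lists: "a' \<in> lists S" "b' \<in> lists S"
      using less.prems a b by (auto simp: reduced_def)
    show ?thesis
    proof (cases "s = t")
      case True
      then show ?thesis using same_head less.prems a b by simp
    next
      case False
      define w where "w = wprod a"
      have w: "wprod a = w" "wprod b = w" using less.prems w_def by auto
      have desc: "len (s \<otimes> w) < len w" "len (t \<otimes> w) < len w"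
      proof -
        have "w = s \<otimes> wprod a'" "w = t \<otimes> wprod b'"
          using w a b by auto
        then have "s \<otimes> w = wprod a'" "t \<otimes> w = wprod b'"
          using st lists by (metis gen_cancel wprod_closed)+
        then show "len (s \<otimes> w) < len w" "len (t \<otimes> w) < len w"
          using less.prems reduced_ConsD[of s a'] reduced_ConsD[of t b'] w a b
          by (auto simp: reduced_def)
      qed
      define m where "m = ord (s \<otimes> t)"
      have m': "m = ord (t \<otimes> s)"
        using ord_inv[of "s \<otimes> t"] st by (simp add: m_def inv_mult_group)
      have "m > 0" using ord_ge_1[OF fin, of "s \<otimes> t"] st by (simp add: m_def)
      \<comment> \<open>Both starting letters are treated at once, because
        \<open>alternating_exchange\<close> turns a prefix starting with one letter into a longer
        prefix starting with the other.\<close>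
      have "Suc j \<le> m \<Longrightarrow> (\<exists>c. reduced (alternating (Suc j) s t @ c) \<and> wprod (alternating (Suc j) s t @ c) = w)
         \<and> (\<exists>c. reduced (alternating (Suc j) t s @ c) \<and> wprod (alternating (Suc j) t s @ c) = w)" for j
      proof (induction j)
        case 0
        then show ?case using less.prems a b w by auto
      next
        case (Suc j)
        then have "Suc j \<le> m" by simp
        from Suc.IH[OF this] obtain c d where
          c: "reduced (alternating (Suc j) s t @ c)" "wprod (alternating (Suc j) s t @ c) = w" and
          d: "reduced (alternating (Suc j) t s @ d)" "wprod (alternating (Suc j) t s @ d) = w"
          by blast
        have j: "Suc j < ord (s \<otimes> t)" "Suc j < ord (t \<otimes> s)"
          using Suc.prems m_def m' by auto
        show ?case
          using alternating_exchange[OF st j(1) c(1)] alternating_exchange[OF st(2,1) j(2) d(1)]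
          unfolding c(2) d(2) using desc by blast
      qed
      from this[of "m - 1"] \<open>m > 0\<close>
      have "(\<exists>c. reduced (alternating m s t @ c) \<and> wprod (alternating m s t @ c) = w)
         \<and> (\<exists>c. reduced (alternating m t s @ c) \<and> wprod (alternating m t s @ c) = w)"
        by (simp only: Suc_diff_1)
      then obtain c d where cd:
        "reduced (alternating m s t @ c)" "wprod (alternating m s t @ c) = w"
        "reduced (alternating m t s @ d)" "wprod (alternating m t s @ d) = w"
        by blast
      have cl: "c \<in> lists S" using cd by (auto simp: reduced_def)
      obtain k where k: "m = Suc k" using \<open>m > 0\<close> by (cases m) auto
      have lens: "length (alternating m s t @ c) = length a" "length (alternating m t s @ d) = length a"
        using cd less.prems w by (auto simp: reduced_def)
      have braid_eq: "wprod (alternating m t s) = wprod (alternating m s t)"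
        using wprod_alternating_swap[of t s m] m' st by simp
      \<comment> \<open>Of the four links from \<open>a\<close> to \<open>b\<close> only the second
        is a braid move; the others join words with the same first letter, so induction applies to
        their tails.\<close>
      have P1: "P a (alternating m s t @ c)"
        using same_head[of s a' "alternating k t s @ c"] less.prems cd(1,2) w a lens(1)
        unfolding k by simp
      have P2: "P (alternating m s t @ c) (alternating m t s @ c)"
        using braid[of s t c] st False cl by (simp add: m_def)
      have P3: "P (alternating m t s @ c) (alternating m t s @ d)"
      proof -
        have "wprod (alternating m t s @ c) = w"
          using cd cl st braid_eq by (simp add: wprod_append)
        moreover have "reduced (alternating m t s @ c)"
          using cl st calculation cd(1,2) by (simp add: reduced_def)
        ultimately show ?thesis
          using same_head[of t "alternating k s t @ c" "alternating k s t @ d"] cd(3,4) lens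
          unfolding k by simp
      qed
      have P4: "P (alternating m t s @ d) b"
        using same_head[of t "alternating k s t @ d" b'] less.prems cd(3,4) w b lens(2)
        unfolding k by simp
      show ?thesis by (rule trans[OF trans[OF trans[OF P1 P2] P3] P4])
    qed
  qed
qed

end

section \<open>The Hecke algebra action on a quasiparabolic set\<close>

lemma (in coxeter_system) gen_reflection: "s \<in> S \<Longrightarrow> s \<in> reflections"
  unfolding reflections_def by (auto intro!: exI[of _ \<one>] exI[of _ s])

lemma (in coxeter_system) reflections_closed: "r \<in> reflections \<Longrightarrow> r \<in> carrier W"
  by (auto simp: reflections_def)

lemma (in coxeter_system) reflections_conj:
  assumes "s \<in> S" "r \<in> reflections"
  shows "s \<otimes> r \<otimes> s \<in> reflections"
proof -
  obtain w t where "w \<in> carrier W" "t \<in> S" "r = w \<otimes> t \<otimes> inv w"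
    using assms by (auto simp: reflections_def)
  moreover from this have "s \<otimes> r \<otimes> s = (s \<otimes> w) \<otimes> t \<otimes> inv (s \<otimes> w)"
    using assms by (simp add: inv_mult_group m_assoc)
  moreover have "s \<otimes> w \<in> carrier W" using assms calculation by simp
  ultimately show ?thesis
    unfolding reflections_def by blast
qed

context quasiparabolic_set
begin

lemma act_closed [simp]: "g \<in> carrier W \<Longrightarrow> x \<in> X \<Longrightarrow> \<phi> g x \<in> X"
  using element_image by blast

lemma act_mult: "g \<in> carrier W \<Longrightarrow> h \<in> carrier W \<Longrightarrow> x \<in> X \<Longrightarrow> \<phi> (g \<otimes> h) x = \<phi> g (\<phi> h x)"
  by (rule composition_rule)

lemma act_one [simp]: "x \<in> X \<Longrightarrow> \<phi> \<one> x = x"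
  using id_eq_one by (metis restrict_apply')

lemma act_gen_gen [simp]: "s \<in> S \<Longrightarrow> x \<in> X \<Longrightarrow> \<phi> s (\<phi> s x) = x"
  by (simp flip: act_mult)

lemma ht_gen_cases:
  assumes "s \<in> S" "x \<in> X"
  obtains "\<phi> s x = x" | "ht (\<phi> s x) = ht x + 1" | "ht (\<phi> s x) = ht x - 1"
  using ht_step[OF assms] QP1[OF gen_reflection assms(2)] assms by fastforce

section \<open>Alternating paths in the orbit of two generators\<close>

primrec path :: "nat \<Rightarrow> 'a \<Rightarrow> 'a \<Rightarrow> 'x \<Rightarrow> 'x" where
  "path 0 s t x = x"
| "path (Suc i) s t x = \<phi> (if even i then s else t) (path i s t x)"

lemma path_closed [simp]: "s \<in> S \<Longrightarrow> t \<in> S \<Longrightarrow> x \<in> X \<Longrightarrow> path i s t x \<in> X"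
  by (induction i) auto

lemma path_eq_act:
  assumes "s \<in> S" "t \<in> S" "x \<in> X"
  shows "path i s t x = \<phi> (wprod (rev (alternating i s t))) x"
proof (induction i)
  case (Suc i)
  then show ?case
    using assms by (simp add: alternating_snoc act_mult del: alternating.simps)
qed (use assms in simp)

text \<open>The two paths apply group elements that differ by the right factor
  \<open>(s \<otimes> t) [^] i\<close>, and each group element acts injectively.\<close>

lemma path_eq_iff:
  assumes st: "s \<in> S" "t \<in> S" and x: "x \<in> X"
  shows "path i s t x = path i t s x \<longleftrightarrow> \<phi> ((s \<otimes> t) [^] i) x = x"
proof -
  let ?a = "\<lambda>s t. wprod (rev (alternating i s t))"
  have "?a t s = ?a s t \<otimes> (s \<otimes> t) [^] i"
  proof -
    have "inv (wprod (alternating i t s)) = inv ((t \<otimes> s) [^] i \<otimes> wprod (alternating i s t))"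
      using wprod_alternating_swap[of t s i] st by simp
    also have "\<dots> = inv (wprod (alternating i s t)) \<otimes> (s \<otimes> t) [^] i"
    proof -
      have "inv ((t \<otimes> s) [^] i) = inv (t \<otimes> s) [^] i"
        using st by (simp only: nat_pow_inv m_closed gen_closed)
      also have "inv (t \<otimes> s) = s \<otimes> t"
        using st by (simp add: inv_mult_group)
      finally show ?thesis using st by (simp add: inv_mult_group)
    qed
    finally show ?thesis using st by (simp add: wprod_rev)
  qed
  then have "path i t s x = \<phi> (?a s t) (\<phi> ((s \<otimes> t) [^] i) x)"
    using assms by (simp add: path_eq_act act_mult)
  moreover have "path i s t x = \<phi> (?a s t) x"
    using assms by (simp add: path_eq_act)
  ultimately show ?thesis
    using inj_prop[of "?a s t"] assms by (auto simp: inj_on_def)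
qed

text \<open>Makes QP1 and QP2 applicable to the ends of the two paths. Both paths use the same next
  generator, so one more step conjugates the reflection by it.\<close>

lemma path_reflection:
  assumes st: "s \<in> S" "t \<in> S" and x: "x \<in> X"
  shows "\<exists>r\<in>reflections. \<phi> r (path i t s x) = path (Suc i) s t x"
proof (induction i)
  case 0
  then show ?case using st x gen_reflection by auto
next
  case (Suc i)
  then obtain r where r: "r \<in> reflections" "\<phi> r (path i t s x) = path (Suc i) s t x"
    by blast
  define p where "p = (if even i then t else s)"
  have p: "p \<in> S" using st by (simp add: p_def)
  have "\<phi> (p \<otimes> r \<otimes> p) (path (Suc i) t s x) = \<phi> p (\<phi> r (path i t s x))"
    using st x p r by (simp add: act_mult reflections_closed flip: p_def)
  also have "\<dots> = path (Suc (Suc i)) s t x"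
    unfolding r by (simp add: p_def)
  finally show ?case using reflections_conj[OF p r(1)] by blast
qed

text \<open>If the next generator fixed the end of the path, QP1 would identify the ends of the two
  paths of length \<open>Suc i\<close>; if it lowered the end, QP2 would. Both contradict
  \<open>neq\<close>.\<close>

lemma path_ascends:
  assumes st: "s \<in> S" "t \<in> S" and x: "x \<in> X"
    and neq: "path (Suc i) s t x \<noteq> path (Suc i) t s x"
    and ht: "ht (path (Suc i) s t x) = ht x + Suc i" "ht (path (Suc i) t s x) = ht x + Suc i"
      "ht (path i t s x) = ht x + i"
  shows "ht (path (Suc (Suc i)) s t x) = ht x + Suc (Suc i)"
proof -
  define p where "p = (if even (Suc i) then s else t)"
  have p: "p \<in> S" using st by (simp add: p_def)
  have u: "path (Suc (Suc i)) s t x = \<phi> p (path (Suc i) s t x)"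
    and v: "path (Suc i) t s x = \<phi> p (path i t s x)"
    by (simp_all add: p_def)
  show ?thesis
  proof (rule ht_gen_cases[OF p, of "path (Suc i) s t x"])
    assume "\<phi> p (path (Suc i) s t x) = path (Suc i) s t x"
    moreover obtain r where "r \<in> reflections" "\<phi> r (path (Suc i) t s x) = path (Suc (Suc i)) s t x"
      using path_reflection[OF st x] by blast
    ultimately have False
      using QP1[of r "path (Suc i) t s x"] st x neq ht u by (metis path_closed)
    then show ?thesis ..
  next
    assume low: "ht (\<phi> p (path (Suc i) s t x)) = ht (path (Suc i) s t x) - 1"
    obtain r where "r \<in> reflections" "\<phi> r (path i t s x) = path (Suc i) s t x"
      using path_reflection[OF st x] by blast
    then have "path (Suc i) s t x = \<phi> p (path i t s x)"
      using QP2[of r "path i t s x" p] p st x ht low v by simp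
    then show ?thesis using v neq by simp
  qed (use st x ht u in simp_all)
qed

lemma path_heights_free:
  assumes st: "s \<in> S" "t \<in> S" and x: "x \<in> X"
    and asc: "ht (\<phi> s x) = ht x + 1" "ht (\<phi> t x) = ht x + 1"
    and neq: "\<And>i. 0 < i \<Longrightarrow> i < k \<Longrightarrow> path i s t x \<noteq> path i t s x"
  shows "i \<le> k \<Longrightarrow> ht (path i s t x) = ht x + i \<and> ht (path i t s x) = ht x + i"
proof (induction i rule: less_induct)
  case (less i)
  consider "i = 0" | "i = 1" | j where "i = Suc (Suc j)"
    by (metis One_nat_def not0_implies_Suc)
  then show ?case
  proof cases
    case 3
    have "path (Suc j) s t x \<noteq> path (Suc j) t s x"
      using neq less.prems 3 by (simp del: path.simps)
    then show ?thesis
      using path_ascends[of s t x j] path_ascends[of t s x j] less.IH[of j] less.IH[of "Suc j"]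
        less.prems st x 3 by (simp del: path.simps)
  qed (use asc in simp_all)
qed

text \<open>As \<open>s\<close> fixes \<open>x\<close>, the path starting with \<open>s\<close> is
  the other one delayed by a step. A stationary step would make the paths meet early. A descending
  first step contradicts \<open>min\<close>; at a later one QP1 identifies two points of equal
  height, and stepping back contradicts the heights already known.\<close>

lemma path_heights_fixed:
  assumes st: "s \<in> S" "t \<in> S" and x: "x \<in> X"
    and fixed: "\<phi> s x = x" and min: "ht x \<le> ht (\<phi> t x)"
    and neq: "\<And>i. 0 < i \<Longrightarrow> i < k \<Longrightarrow> path i s t x \<noteq> path i t s x"
  shows "i < k \<Longrightarrow> ht (path i t s x) = ht x + i"
proof (induction i rule: less_induct)
  case (less i)
  have shift: "path (Suc j) s t x = path j t s x" for j
    by (induction j) (simp_all add: fixed)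
  show ?case
  proof (cases i)
    case (Suc i')
    define p where "p = (if even i' then t else s)"
    have p: "p \<in> S" using st by (simp add: p_def)
    have v: "path i t s x = \<phi> p (path i' t s x)"
      by (simp add: p_def Suc)
    have IH: "ht (path i' t s x) = ht x + i'"
      using less Suc by simp
    have moved: "\<phi> p (path i' t s x) \<noteq> path i' t s x"
      using neq[of i] less.prems Suc v shift[of i'] by simp
    show ?thesis
    proof (rule ht_gen_cases[OF p, of "path i' t s x"])
      assume low: "ht (\<phi> p (path i' t s x)) = ht (path i' t s x) - 1"
      show ?thesis
      proof (cases i')
        case 0
        then show ?thesis using low min by (simp add: p_def)
      next
        case (Suc j)
        have "ht (path j t s x) = ht x + j"
          using less.IH[of j] less.prems \<open>i = Suc i'\<close> Suc by simp
        then have "ht (path i' s t x) = ht (path i t s x)"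
          using shift[of j] Suc IH low v by simp
        moreover obtain r where "r \<in> reflections" "\<phi> r (path i' s t x) = path i t s x"
          using path_reflection[OF st(2,1) x, of i'] \<open>i = Suc i'\<close> by blast
        ultimately have "path i' s t x = \<phi> p (path i' t s x)"
          using QP1[of r "path i' s t x"] st x v by simp
        then have "\<phi> p (path i' s t x) = path i' t s x"
          using p st x by simp
        moreover have "\<phi> p (path i' s t x) = path j s t x"
          using st x by (simp add: Suc p_def)
        moreover have "ht (path j s t x) \<le> ht x + j"
        proof (cases j)
          case (Suc l)
          then show ?thesis
            using less.IH[of l] less.prems \<open>i = Suc i'\<close> \<open>i' = Suc j\<close> shift[of l] by simp
        qed simp
        ultimately show ?thesis using IH Suc by simp
      qed
    qed (use st x moved IH v Suc in simp_all)
  qed simp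
qed

section \<open>Hecke operators and their braid relations\<close>

text \<open>
  The transpose of the action of \<open>T\<^sub>s\<close> on the free module over \<open>X\<close>: \<open>hecke z s f x = f (T\<^sub>s x)\<close> with \<open>f\<close>
  extended linearly.
\<close>

definition hecke :: "'k::comm_ring_1 \<Rightarrow> 'a \<Rightarrow> ('x \<Rightarrow> 'k) \<Rightarrow> 'x \<Rightarrow> 'k" where
  "hecke z s f x =
    (if ht x < ht (\<phi> s x) then f (\<phi> s x)
     else if \<phi> s x = x then z * f x
     else z * f (\<phi> s x) + (z - 1) * f x)"

abbreviation hecke_word :: "'k::comm_ring_1 \<Rightarrow> 'a list \<Rightarrow> ('x \<Rightarrow> 'k) \<Rightarrow> 'x \<Rightarrow> 'k" where
  "hecke_word z \<equiv> foldr (hecke z)"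

lemma hecke_square:
  assumes "s \<in> S" "x \<in> X"
  shows "hecke z s (hecke z s f) x = (z - 1) * hecke z s f x + z * f x"
  by (rule ht_gen_cases[OF assms]) (use assms in \<open>auto simp: hecke_def algebra_simps\<close>)

text \<open>The hypothesis is confined to \<open>X\<close> so that \<open>hecke_square\<close>,
  valid on \<open>X\<close> only, can be used inside a word.\<close>

lemma hecke_linear:
  assumes "s \<in> S" "x \<in> X" "\<And>y. y \<in> X \<Longrightarrow> f y = a * g y + b * h y"
  shows "hecke z s f x = a * hecke z s g x + b * hecke z s h x"
  using assms by (simp add: hecke_def algebra_simps)

lemma hecke_word_linear:
  assumes "u \<in> lists S" "x \<in> X" "\<And>y. y \<in> X \<Longrightarrow> f y = a * g y + b * h y"
  shows "hecke_word z u f x = a * hecke_word z u g x + b * hecke_word z u h x"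
  using assms
proof (induction u arbitrary: x)
  case (Cons s u)
  then show ?case
    using hecke_linear[of s x "hecke_word z u f" a "hecke_word z u g" b "hecke_word z u h" z] by simp
qed simp

text \<open>Transposition reverses composition, so the first letter of the word moves
  \<open>x\<close> first, in the order of \<open>path\<close>; on an ascending step the operator
  merely moves the point.\<close>

lemma hecke_word_ascending:
  assumes "s \<in> S" "t \<in> S" "x \<in> X" "\<And>j. j < i \<Longrightarrow> ht (path j s t x) < ht (path (Suc j) s t x)"
  shows "hecke_word z (alternating i s t) f x = f (path i s t x)"
  using assms(4)
proof (induction i arbitrary: f)
  case (Suc i)
  then show ?case
    by (simp add: alternating_snoc hecke_def del: alternating.simps)
qed simp

definition braid_at :: "'k::comm_ring_1 \<Rightarrow> nat \<Rightarrow> 'a \<Rightarrow> 'a \<Rightarrow> 'x \<Rightarrow> bool" where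
  "braid_at z k s t x \<longleftrightarrow>
    (\<forall>f. hecke_word z (alternating k s t) f x = hecke_word z (alternating k t s) f x)"

lemma braid_at_sym: "braid_at z k s t x \<longleftrightarrow> braid_at z k t s x"
  by (auto simp: braid_at_def)

text \<open>One word picks up the factor \<open>z\<close> at once, at the point \<open>x\<close>
  fixed by \<open>s\<close>, and then climbs \<open>k - 1\<close> steps. The other climbs the same
  steps and picks up \<open>z\<close> at the end: that the paths meet says that its last letter
  fixes the top.\<close>

lemma braid_at_fixed:
  assumes st: "s \<in> S" "t \<in> S" and x: "x \<in> X"
    and fixed: "\<phi> s x = x" and min: "ht x \<le> ht (\<phi> t x)"
    and k: "0 < k" "path k s t x = path k t s x"
    and neq: "\<And>i. 0 < i \<Longrightarrow> i < k \<Longrightarrow> path i s t x \<noteq> path i t s x"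
  shows "braid_at z k s t x"
  unfolding braid_at_def
proof
  fix f
  obtain j where j: "k = Suc j" using k by (cases k) auto
  have ht: "ht (path i t s x) = ht x + i" if "i \<le> j" for i
    by (rule path_heights_fixed[OF st x fixed min, where k = k]) (use neq that j in simp_all)
  have up: "hecke_word z (alternating j t s) g x = g (path j t s x)" for g
    by (rule hecke_word_ascending) (use st x ht in \<open>simp_all del: path.simps\<close>)
  have "path (Suc i) s t x = path i t s x" for i
    by (induction i) (simp_all add: fixed)
  moreover define p where "p = (if even j then t else s)"
  ultimately have "\<phi> p (path j t s x) = path j t s x"
    using k j by simp
  then have "hecke z p f (path j t s x) = z * f (path j t s x)"
    by (simp add: hecke_def)
  then have "hecke_word z (alternating k t s) f x = z * f (path j t s x)"
    unfolding j alternating_snoc by (simp add: up p_def)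
  moreover have "hecke_word z (alternating k s t) f x = z * f (path j t s x)"
    by (simp add: j hecke_def fixed up)
  ultimately show "hecke_word z (alternating k s t) f x = hecke_word z (alternating k t s) f x"
    by simp
qed

lemma braid_at_free:
  assumes st: "s \<in> S" "t \<in> S" and x: "x \<in> X"
    and asc: "ht (\<phi> s x) = ht x + 1" "ht (\<phi> t x) = ht x + 1"
    and k: "path k s t x = path k t s x"
    and neq: "\<And>i. 0 < i \<Longrightarrow> i < k \<Longrightarrow> path i s t x \<noteq> path i t s x"
  shows "braid_at z k s t x"
proof -
  note ht = path_heights_free[OF st x asc neq]
  have "hecke_word z (alternating k s t) f x = f (path k s t x)"
    "hecke_word z (alternating k t s) f x = f (path k t s x)" for f
    by (rule hecke_word_ascending; use st x ht in \<open>simp del: path.simps\<close>)+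
  then show ?thesis using k by (simp add: braid_at_def)
qed

text \<open>
  With \<open>A\<close> and \<open>B\<close> the two alternating products, \<open>T\<^sub>s B = A T\<^sub>p\<close> for a generator \<open>p\<close>, and \<open>A T\<^sub>p\<close> may be replaced by
  \<open>B T\<^sub>p\<close>, where \<open>T\<^sub>p\<^sup>2\<close> can be reduced by the quadratic relation.
\<close>

lemma braid_at_extend:
  assumes st: "s \<in> S" "t \<in> S" and x: "x \<in> X" and w: "w \<in> lists S"
    and eq: "\<And>f. hecke_word z w (hecke_word z (alternating (Suc k) s t) f) x
      = hecke_word z w (hecke_word z (alternating (Suc k) t s) f) x"
  shows "hecke_word z (w @ [s]) (hecke_word z (alternating (Suc k) s t) f) x
    = hecke_word z (w @ [s]) (hecke_word z (alternating (Suc k) t s) f) x"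
proof -
  define p where "p = (if even k then t else s)"
  have p: "p \<in> S" using st by (simp add: p_def)
  let ?A = "hecke_word z (alternating (Suc k) s t)"
  let ?B = "hecke_word z (alternating (Suc k) t s)"
  let ?C = "hecke_word z (alternating k t s)"
  have B: "?B g = ?C (hecke z p g)" for g
    unfolding alternating_snoc by (simp add: p_def)
  have "hecke z s (?B f) = ?A (hecke z p f)"
    using fun_cong[OF arg_cong[of "alternating (Suc (Suc k)) s t" _ "hecke_word z"], of _ f]
    by (subst (asm) alternating_snoc[of "Suc k"]) (simp add: p_def if_distrib)
  then have "hecke_word z (w @ [s]) (?B f) x = hecke_word z w (?B (hecke z p f)) x"
    using eq by simp
  also have "\<dots> = hecke_word z (w @ alternating k t s) (hecke z p (hecke z p f)) x"
    by (simp add: B del: alternating.simps)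
  also have "\<dots> = (z - 1) * hecke_word z (w @ alternating k t s) (hecke z p f) x
      + z * hecke_word z (w @ alternating k t s) f x"
    by (rule hecke_word_linear) (use w st x p in \<open>simp_all add: hecke_square\<close>)
  also have "\<dots> = (z - 1) * hecke_word z w (?A f) x + z * hecke_word z w (?C f) x"
    by (simp add: eq B del: alternating.simps)
  also have "\<dots> = hecke_word z w (hecke z s (hecke z s (?C f))) x"
    by (rule hecke_word_linear[symmetric]) (use w st x in \<open>simp_all add: hecke_square\<close>)
  finally show ?thesis by simp
qed

text \<open>Agreement at \<open>x\<close> spreads to all multiples by words in \<open>s\<close> and
  \<open>t\<close>, one trailing letter at a time by \<open>braid_at_extend\<close>.\<close>

lemma braid_at_module:
  assumes st: "s \<in> S" "t \<in> S" and x: "x \<in> X" and w: "w \<in> lists {s, t}"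
    and k: "0 < k" and "braid_at z k s t x"
  shows "hecke_word z w (hecke_word z (alternating k s t) f) x
    = hecke_word z w (hecke_word z (alternating k t s) f) x"
  using w
proof (induction w arbitrary: f rule: rev_induct)
  case Nil
  then show ?case using assms by (simp add: braid_at_def)
next
  case (snoc p w)
  obtain j where j: "k = Suc j" using k by (cases k) auto
  have w: "w \<in> lists {s, t}" "w \<in> lists S" and p: "p = s \<or> p = t"
    using snoc.prems st by (auto simp: in_lists_conv_set)
  note IH = snoc.IH[OF w(1)]
  from p show ?case
    using braid_at_extend[OF st x w(2), of z j f] braid_at_extend[OF st(2,1) x w(2), of z j f] IH
    unfolding j by metis
qed

text \<open>The leading block of length \<open>k\<close> is exchanged by hypothesis; the remaining
  block sits behind a word in \<open>s\<close> and \<open>t\<close> and is exchanged by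
  \<open>braid_at_module\<close>. The parity of \<open>k\<close> decides its first letter.\<close>

lemma braid_at_mult:
  assumes st: "s \<in> S" "t \<in> S" and x: "x \<in> X" and k: "0 < k" "braid_at z k s t x"
  shows "braid_at z (n * k) s t x"
proof (induction n)
  case (Suc n)
  show ?case
  proof (cases "n = 0")
    case False
    define a b where "a = (if even k then s else t)" and "b = (if even k then t else s)"
    have split: "alternating (Suc n * k) s t = alternating k s t @ alternating (n * k) a b"
      "alternating (Suc n * k) t s = alternating k t s @ alternating (n * k) b a"
      by (simp_all add: alternating_add a_def b_def)
    have ab: "a \<in> S" "b \<in> S" "braid_at z (n * k) a b x" "alternating k t s \<in> lists {a, b}"
      using st Suc braid_at_sym[of z] by (auto simp: a_def b_def)
    show ?thesis
      unfolding braid_at_def split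
      using k braid_at_module[OF ab(1,2) x ab(4) _ ab(3)] False
      by (auto simp: braid_at_def)
  qed (use k in simp)
qed (simp add: braid_at_def)

lemma braid_at_local_min:
  assumes st: "s \<in> S" "t \<in> S" and x: "x \<in> X"
    and min: "ht x \<le> ht (\<phi> s x)" "ht x \<le> ht (\<phi> t x)"
    and m: "0 < m" "(s \<otimes> t) [^] m = \<one>"
  shows "braid_at z m s t x"
proof -
  let ?fix = "\<lambda>k::nat. \<phi> ((s \<otimes> t) [^] k) x = x"
  \<comment> \<open>The alternating paths from \<open>x\<close> first meet after \<open>k\<close> steps, where \<open>k\<close> divides \<open>m\<close>; up to
    there heights increase, so the braid relation of length \<open>k\<close> can be read off.\<close>
  define k where "k = (LEAST k. 0 < k \<and> ?fix k)"
  have m': "0 < m \<and> ?fix m" using m x by simp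
  have k: "0 < k" "?fix k"
    using LeastI[of "\<lambda>k. 0 < k \<and> ?fix k", OF m'] by (auto simp: k_def)
  have least: "\<not> ?fix i" if "0 < i" "i < k" for i
    using not_less_Least[of i "\<lambda>k. 0 < k \<and> ?fix k"] that by (auto simp: k_def)
  have neq: "path i s t x \<noteq> path i t s x" if "0 < i" "i < k" for i
    using least[OF that] path_eq_iff[OF st x] by simp
  have eq: "path k s t x = path k t s x"
    using k path_eq_iff[OF st x] by simp
  have fix_mult: "?fix (n * k)" for n
  proof (induction n)
    case (Suc n)
    have "(s \<otimes> t) [^] (Suc n * k) = (s \<otimes> t) [^] k \<otimes> (s \<otimes> t) [^] (n * k)"
      using st by (simp add: nat_pow_mult)
    then show ?case using Suc k st x by (simp add: act_mult)
  qed (use x in simp)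
  have "?fix (m mod k)"
  proof -
    have "(s \<otimes> t) [^] m = (s \<otimes> t) [^] (m mod k) \<otimes> (s \<otimes> t) [^] (m div k * k)"
      using st by (simp add: nat_pow_mult)
    then have "x = \<phi> ((s \<otimes> t) [^] (m mod k)) (\<phi> ((s \<otimes> t) [^] (m div k * k)) x)"
      using m' st x by (metis act_mult gen_closed m_closed nat_pow_closed)
    then show ?thesis using fix_mult by simp
  qed
  then have "m mod k = 0"
    using least[of "m mod k"] k by auto
  moreover have "braid_at z k s t x"
  proof -
    consider "\<phi> s x = x" | "\<phi> t x = x" | "ht (\<phi> s x) = ht x + 1" "ht (\<phi> t x) = ht x + 1"
      using ht_gen_cases[OF st(1) x] ht_gen_cases[OF st(2) x] min by smt
    then show ?thesis
    proof cases
      case 1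
      then show ?thesis using braid_at_fixed[OF st x _ min(2) k(1) eq neq] by blast
    next
      case 2
      then have "braid_at z k t s x"
        using braid_at_fixed[OF st(2,1) x _ min(1) k(1) eq[symmetric] neq[symmetric]] by blast
      then show ?thesis using braid_at_sym by blast
    next
      case 3
      then show ?thesis using braid_at_free[OF st x _ _ eq neq] by blast
    qed
  qed
  ultimately show ?thesis
    using braid_at_mult[OF st x k(1), of z "m div k"] by (simp add: mod_0_imp_dvd)
qed

text \<open>If \<open>p\<close> lowers \<open>x\<close>, the operator of \<open>p\<close> evaluated
  at \<open>\<phi> p x\<close> is evaluation at \<open>x\<close>, so \<open>braid_at_module\<close>
  lifts the relation from the lower point. Heights bounded below make the descent end at a local
  minimum.\<close>

lemma braid_at_ord:
  assumes bounded: "\<And>y. y \<in> X \<Longrightarrow> 0 \<le> ht y"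
    and st: "s \<in> S" "t \<in> S" and "0 < ord (s \<otimes> t)" and x: "x \<in> X"
  shows "braid_at z (ord (s \<otimes> t)) s t x"
  using x
proof (induction "nat (ht x)" arbitrary: x rule: less_induct)
  case less
  let ?m = "ord (s \<otimes> t)"
  have down: "braid_at z ?m s t x" if p: "p = s \<or> p = t" "ht (\<phi> p x) < ht x" for p
  proof -
    have y: "p \<in> S" "\<phi> p x \<in> X" using p st less.prems by auto
    then have "braid_at z ?m s t (\<phi> p x)"
      using less.hyps[of "\<phi> p x"] p bounded[of "\<phi> p x"] by simp
    moreover have "[p] \<in> lists {s, t}" using p by simp
    ultimately have "hecke_word z [p] (hecke_word z (alternating ?m s t) f) (\<phi> p x)
      = hecke_word z [p] (hecke_word z (alternating ?m t s) f) (\<phi> p x)" for f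
      using braid_at_module[OF st y(2)] assms by blast
    then show ?thesis
      using p y less.prems by (simp add: braid_at_def hecke_def)
  qed
  show ?case
  proof (cases "ht (\<phi> s x) < ht x \<or> ht (\<phi> t x) < ht x")
    case True
    then show ?thesis using down by blast
  next
    case False
    then show ?thesis
      by (intro braid_at_local_min) (use st less.prems assms in auto)
  qed
qed

section \<open>Operators indexed by the elements of a finite W, and their sum\<close>

context
  assumes fin: "finite (carrier W)" and bounded: "\<And>y. y \<in> X \<Longrightarrow> 0 \<le> ht y"
begin

lemma hecke_word_reduced:
  assumes ab: "reduced a" "reduced b" "wprod a = wprod b" and x: "x \<in> X"
  shows "hecke_word z a f x = hecke_word z b f x"
proof -
  define P where "P u v \<longleftrightarrow> (\<forall>f. \<forall>x\<in>X. hecke_word z u f x = hecke_word z v f x)" for u v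
  have "P a b"
  proof (rule matsumoto[OF fin _ _ _ _ _ ab])
    fix s u v assume "s \<in> S" "P u v"
    then show "P (s # u) (s # v)"
      by (simp add: P_def hecke_def)
  next
    fix s t u assume st: "s \<in> S" "t \<in> S" "s \<noteq> t" "u \<in> lists S"
    have "0 < ord (s \<otimes> t)"
      using ord_ge_1[OF fin, of "s \<otimes> t"] st by simp
    then have "braid_at z (ord (s \<otimes> t)) s t x" if "x \<in> X" for x
      using braid_at_ord[OF bounded st(1,2) _ that] by simp
    then show "P (alternating (ord (s \<otimes> t)) s t @ u) (alternating (ord (s \<otimes> t)) t s @ u)"
      by (simp add: P_def braid_at_def)
  qed (simp_all add: P_def)
  then show ?thesis using x by (simp add: P_def)
qed

definition hecke_elt :: "'k::comm_ring_1 \<Rightarrow> 'a \<Rightarrow> ('x \<Rightarrow> 'k) \<Rightarrow> 'x \<Rightarrow> 'k" where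
  "hecke_elt z w = hecke_word z (SOME u. reduced u \<and> wprod u = w)"

definition hecke_sum :: "'k::comm_ring_1 \<Rightarrow> ('x \<Rightarrow> 'k) \<Rightarrow> 'x \<Rightarrow> 'k" where
  "hecke_sum z f x = (\<Sum>w\<in>carrier W. hecke_elt z w f x)"

lemma hecke_elt_obtain:
  assumes "w \<in> carrier W"
  obtains u where "reduced u" "wprod u = w" "hecke_elt z w = hecke_word z u"
proof -
  let ?u = "SOME u. reduced u \<and> wprod u = w"
  have "reduced ?u \<and> wprod ?u = w"
    by (rule someI_ex) (use reduced_exists[OF assms] in blast)
  then show thesis using that[of ?u] by (simp add: hecke_elt_def)
qed

lemma hecke_elt_linear:
  assumes "w \<in> carrier W" "x \<in> X" "\<And>y. y \<in> X \<Longrightarrow> f y = a * g y + b * h y"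
  shows "hecke_elt z w f x = a * hecke_elt z w g x + b * hecke_elt z w h x"
proof -
  obtain u where u: "reduced u" "hecke_elt z w = hecke_word z u"
    by (rule hecke_elt_obtain[OF assms(1), of z])
  show ?thesis
    unfolding u(2) by (rule hecke_word_linear[OF reduced_lists[OF u(1)] assms(2,3)])
qed

lemma hecke_sum_linear:
  assumes "x \<in> X" "\<And>y. y \<in> X \<Longrightarrow> f y = a * g y + b * h y"
  shows "hecke_sum z f x = a * hecke_sum z g x + b * hecke_sum z h x"
proof -
  have "hecke_elt z w f x = a * hecke_elt z w g x + b * hecke_elt z w h x" if "w \<in> carrier W" for w
    by (rule hecke_elt_linear[OF that assms])
  then show ?thesis
    by (simp add: hecke_sum_def sum.distrib sum_distrib_left)
qed

lemma hecke_sum_cong: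
  assumes "x \<in> X" "\<And>y. y \<in> X \<Longrightarrow> f y = g y"
  shows "hecke_sum z f x = hecke_sum z g x"
  using hecke_sum_linear[of x f 1 g 0 g z] assms by simp

lemma hecke_sum_sum:
  assumes "x \<in> X" "finite Y"
  shows "hecke_sum z (\<lambda>v. \<Sum>y\<in>Y. c y * d y v) x = (\<Sum>y\<in>Y. c y * hecke_sum z (d y) x)"
  using assms(2)
proof (induction Y)
  case empty
  show ?case
    using hecke_sum_linear[of x "\<lambda>_. 0" 0 "\<lambda>_. 0" 0 "\<lambda>_. 0" z] assms(1) by simp
next
  case (insert y Y)
  then show ?case
    using hecke_sum_linear[of x "\<lambda>v. c y * d y v + (\<Sum>y\<in>Y. c y * d y v)" "c y" "d y" 1
        "\<lambda>v. \<Sum>y\<in>Y. c y * d y v" z] assms(1) by simp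
qed

lemma hecke_elt_gen:
  assumes s: "s \<in> S" and w: "w \<in> carrier W" "len w < len (w \<otimes> s)" and x: "x \<in> X"
  shows "hecke_elt z w (hecke z s f) x = hecke_elt z (w \<otimes> s) f x"
proof -
  obtain u where u: "reduced u" "wprod u = w" "hecke_elt z w = hecke_word z u"
    by (rule hecke_elt_obtain[OF w(1), of z])
  obtain v where v: "reduced v" "wprod v = w \<otimes> s" "hecke_elt z (w \<otimes> s) = hecke_word z v"
    by (rule hecke_elt_obtain[of "w \<otimes> s" z]) (use w s in auto)
  have eq: "wprod (u @ [s]) = w \<otimes> s"
    using u s by (simp add: wprod_append reduced_lists)
  have "reduced (u @ [s])"
    using u s w len_mult_gen[of s w] eq by (auto simp: reduced_def)
  then have "hecke_word z (u @ [s]) f x = hecke_word z v f x"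
    using v eq x by (intro hecke_word_reduced) simp_all
  then show ?thesis using u v by simp
qed

text \<open>Pair \<open>w\<close> with the longer \<open>w \<otimes> s\<close>: by the quadratic
  relation (T_w + T_ws) T_s = T_ws + (z - 1) T_ws + z T_w = z (T_w + T_ws).\<close>

lemma hecke_sum_gen:
  assumes s: "s \<in> S" and x: "x \<in> X"
  shows "hecke_sum z (hecke z s f) x = z * hecke_sum z f x"
proof -
  define U where "U = {w \<in> carrier W. len w < len (w \<otimes> s)}"
  define D where "D = {w \<in> carrier W. len (w \<otimes> s) < len w}"
  have split: "carrier W = U \<union> D" "U \<inter> D = {}"
  proof -
    have "len w < len (w \<otimes> s) \<or> len (w \<otimes> s) < len w" if "w \<in> carrier W" for w
      using len_mult_gen[OF s that] by auto
    then show "carrier W = U \<union> D" "U \<inter> D = {}" by (auto simp: U_def D_def)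
  qed
  have fins: "finite U" "finite D"
    using fin by (auto simp: U_def D_def)
  have ss: "w \<otimes> s \<otimes> s = w" if "w \<in> carrier W" for w
    using that s by (simp add: m_assoc)
  have bij: "bij_betw (\<lambda>w. w \<otimes> s) U D"
    by (rule bij_betw_byWitness[where f' = "\<lambda>w. w \<otimes> s"]) (use s ss in \<open>auto simp: U_def D_def\<close>)
  have sum_split: "sum F (carrier W) = (\<Sum>w\<in>U. F w + F (w \<otimes> s))" for F :: "'a \<Rightarrow> 'k::comm_ring_1"
    unfolding split(1) sum.union_disjoint[OF fins split(2)] sum.distrib
    using sum.reindex_bij_betw[OF bij, of F] by simp
  let ?g = "\<lambda>w. hecke_elt z w f x"
  let ?h = "\<lambda>w. hecke_elt z w (hecke z s f) x"
  have "?h w + ?h (w \<otimes> s) = z * (?g w + ?g (w \<otimes> s))" if "w \<in> U" for w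
  proof -
    have w: "w \<in> carrier W" "len w < len (w \<otimes> s)" using that by (auto simp: U_def)
    have h: "?h w = ?g (w \<otimes> s)"
      by (rule hecke_elt_gen[OF s w x])
    have "?h (w \<otimes> s) = hecke_elt z w (hecke z s (hecke z s f)) x"
      by (rule hecke_elt_gen[OF s w x, symmetric])
    also have "\<dots> = (z - 1) * ?h w + z * ?g w"
      by (rule hecke_elt_linear[OF w(1) x hecke_square[OF s]])
    finally show ?thesis using h by (simp add: algebra_simps)
  qed
  then show ?thesis
    unfolding hecke_sum_def sum_split by (simp add: sum_distrib_left)
qed

text \<open>The operator sends the point mass at \<open>\<phi> s y\<close> to the one at
  \<open>y\<close> plus \<open>z - 1\<close> times itself. Comparison with the eigenvalue
  \<open>z\<close> from \<open>hecke_sum_gen\<close> cancels without dividing by \<open>z\<close>,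
  so any commutative ring will do.\<close>

lemma hecke_sum_delta_ascending:
  assumes s: "s \<in> S" and x: "x \<in> X" and y: "y \<in> X" "ht y < ht (\<phi> s y)"
  shows "hecke_sum z (\<lambda>v. of_bool (v = \<phi> s y)) x = hecke_sum z (\<lambda>v. of_bool (v = y)) x"
proof -
  let ?d = "\<lambda>y v. of_bool (v = y)"
  have "hecke z s (?d (\<phi> s y)) v = 1 * ?d y v + (z - 1) * ?d (\<phi> s y) v" if "v \<in> X" for v
  proof -
    have "\<phi> s v = \<phi> s y \<longleftrightarrow> v = y"
      using that y s by (metis act_gen_gen)
    moreover have "\<phi> s (\<phi> s y) = y" using y s by simp
    ultimately show ?thesis using y by (auto simp: hecke_def)
  qed
  then have "hecke_sum z (hecke z s (?d (\<phi> s y))) x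
    = 1 * hecke_sum z (?d y) x + (z - 1) * hecke_sum z (?d (\<phi> s y)) x"
    using x by (rule hecke_sum_linear[rotated])
  then show ?thesis
    unfolding hecke_sum_gen[OF s x] by (simp add: algebra_simps)
qed

lemma hecke_sum_delta:
  assumes w: "w \<in> carrier W" and x: "x \<in> X" and y: "y \<in> X"
  shows "hecke_sum z (\<lambda>v. of_bool (v = \<phi> w y)) x = hecke_sum z (\<lambda>v. of_bool (v = y)) x"
proof -
  have gen: "hecke_sum z (\<lambda>v. of_bool (v = \<phi> s y)) x = hecke_sum z (\<lambda>v. of_bool (v = y)) x"
    if s: "s \<in> S" and y: "y \<in> X" for s y
  proof (rule ht_gen_cases[OF s y])
    assume "ht (\<phi> s y) = ht y + 1"
    then show ?thesis
      using hecke_sum_delta_ascending[OF s x y] by simp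
  next
    assume "ht (\<phi> s y) = ht y - 1"
    then show ?thesis
      using hecke_sum_delta_ascending[OF s x, of "\<phi> s y" z] s y by simp
  qed simp
  obtain u where "u \<in> lists S" "wprod u = w"
    using word_exists[OF w] .
  then show ?thesis
  proof (induction u arbitrary: w)
    case (Cons s u)
    then show ?case using gen[of s "\<phi> (wprod u) y"] y by (auto simp: act_mult)
  qed (use y in simp)
qed

text \<open>Each operator has this function as an eigenvector with eigenvalue \<open>z\<close>; on a
  descending step this is \<open>z * z ^ n + (z - 1) * z ^ Suc n = z * z ^ Suc n\<close>.\<close>

lemma hecke_word_power_ht:
  assumes "u \<in> lists S" "x \<in> X"
  shows "hecke_word z u (\<lambda>x. z ^ nat (ht x)) x = z ^ length u * z ^ nat (ht x)"
  using assms
proof (induction u arbitrary: x)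
  case (Cons s u)
  let ?f = "\<lambda>x. z ^ nat (ht x)"
  have "hecke z s ?f x = z * ?f x"
  proof (rule ht_gen_cases[OF \<open>s \<in> S\<close> \<open>x \<in> X\<close>])
    assume up: "ht (\<phi> s x) = ht x + 1"
    then have "nat (ht (\<phi> s x)) = Suc (nat (ht x))"
      using bounded[OF \<open>x \<in> X\<close>] by simp
    with up show ?thesis by (simp add: hecke_def)
  next
    assume down: "ht (\<phi> s x) = ht x - 1"
    then have neq: "\<not> ht x < ht (\<phi> s x)" "\<phi> s x \<noteq> x" by auto
    define n where "n = nat (ht (\<phi> s x))"
    have "nat (ht x) = Suc n"
      using bounded[of "\<phi> s x"] Cons down by (simp add: n_def)
    then show ?thesis
      using neq by (simp add: hecke_def algebra_simps flip: n_def)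
  qed (simp add: hecke_def)
  moreover have "hecke z s (hecke_word z u ?f) x = z ^ length u * hecke z s ?f x + 0 * hecke z s ?f x"
    using Cons by (intro hecke_linear) simp_all
  ultimately show ?case by (simp add: algebra_simps)
qed simp

theorem poincare_dvd:
  fixes z :: "'k::comm_ring_1"
  assumes x: "x \<in> X" "ht x = 0" and transitive: "\<And>y. y \<in> X \<Longrightarrow> \<exists>w\<in>carrier W. \<phi> w x = y"
  shows "(\<Sum>y\<in>X. z ^ nat (ht y)) dvd (\<Sum>w\<in>carrier W. z ^ len w)"
proof -
  let ?f = "\<lambda>y. z ^ nat (ht y)"
  let ?c = "hecke_sum z (\<lambda>v. of_bool (v = x)) x"
  have "X \<subseteq> (\<lambda>w. \<phi> w x) ` carrier W" using transitive by blast
  then have "finite X" using fin finite_surj by blast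
  have "hecke_elt z w ?f x = z ^ len w" if w: "w \<in> carrier W" for w
  proof -
    obtain u where "reduced u" "wprod u = w" "hecke_elt z w = hecke_word z u"
      by (rule hecke_elt_obtain[OF w, of z])
    then show ?thesis
      using hecke_word_power_ht[OF _ x(1), of u z] x(2) by (simp add: reduced_def)
  qed
  then have "(\<Sum>w\<in>carrier W. z ^ len w) = hecke_sum z ?f x"
    by (simp add: hecke_sum_def)
  also have "\<dots> = hecke_sum z (\<lambda>v. \<Sum>y\<in>X. ?f y * of_bool (v = y)) x"
    using \<open>finite X\<close> by (intro hecke_sum_cong x) (simp add: if_distrib sum.delta of_bool_def cong: if_cong)
  also have "\<dots> = (\<Sum>y\<in>X. ?f y * hecke_sum z (\<lambda>v. of_bool (v = y)) x)"
    using x(1) \<open>finite X\<close> by (rule hecke_sum_sum)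
  also have "\<dots> = (\<Sum>y\<in>X. ?f y * ?c)"
  proof (intro sum.cong refl)
    fix y assume "y \<in> X"
    then obtain w where w: "w \<in> carrier W" "\<phi> w x = y" using transitive by blast
    show "?f y * hecke_sum z (\<lambda>v. of_bool (v = y)) x = ?f y * ?c"
      using hecke_sum_delta[OF w(1) x(1) x(1), of z] w(2) by simp
  qed
  also have "\<dots> = (\<Sum>y\<in>X. ?f y) * ?c"
    by (simp add: sum_distrib_right)
  finally show ?thesis by simp
qed

end

end

section \<open>Parabolic subgroups and the roots of the Poincare polynomial\<close>

lemma sum_Pow_alternating:
  assumes "finite A"
  shows "(\<Sum>J\<in>Pow A. (- 1) ^ card J :: 'a::comm_ring_1) = of_bool (A = {})"
proof -
  have "(\<Prod>a\<in>A. (- 1) + 1 :: 'a) = (\<Sum>J\<in>Pow A. (\<Prod>a\<in>J. - 1) * (\<Prod>a\<in>A - J. 1))"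
    using assms by (rule prod_add)
  then have "(\<Sum>J\<in>Pow A. (- 1) ^ card J :: 'a) = 0 ^ card A" by simp
  then show ?thesis using assms by (simp add: power_0_left)
qed

context coxeter_system
begin

section \<open>Minimal and longest elements for a parabolic subgroup\<close>

definition parabolic :: "'a set \<Rightarrow> 'a set" where
  "parabolic I = wprod ` lists I"

definition left_min :: "'a set \<Rightarrow> 'a \<Rightarrow> bool" where
  "left_min J u \<longleftrightarrow> (\<forall>s\<in>J. len u < len (s \<otimes> u))"

lemma parabolic_gens: "parabolic S = carrier W"
proof (intro equalityI subsetI)
  fix w assume "w \<in> carrier W"
  then obtain u where "u \<in> lists S" "wprod u = w" by (rule word_exists)
  then show "w \<in> parabolic S" by (auto simp: parabolic_def)
qed (auto simp: parabolic_def)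

lemma parabolic_mono: "I \<subseteq> J \<Longrightarrow> parabolic I \<subseteq> parabolic J"
  using lists_mono[of I J] by (auto simp: parabolic_def)

lemma parabolic_empty: "parabolic {} = {\<one>}"
  by (auto simp: parabolic_def)

lemma parabolic_one [simp]: "\<one> \<in> parabolic I"
  unfolding parabolic_def by (rule image_eqI[of _ _ "[]"]) simp_all

context
  fixes I assumes I: "I \<subseteq> S"
begin

lemma parabolic_carrier: "w \<in> parabolic I \<Longrightarrow> w \<in> carrier W"
  using parabolic_mono[OF I] parabolic_gens by auto

lemma lists_parabolic_gens: "u \<in> lists I \<Longrightarrow> u \<in> lists S"
  using lists_mono[OF I] by blast

lemma parabolic_gen: "s \<in> I \<Longrightarrow> s \<in> parabolic I"
  unfolding parabolic_def using I by (intro image_eqI[of _ _ "[s]"]) auto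

lemma parabolic_mult:
  assumes "v \<in> parabolic I" "w \<in> parabolic I"
  shows "v \<otimes> w \<in> parabolic I"
proof -
  obtain a b where "a \<in> lists I" "wprod a = v" "b \<in> lists I" "wprod b = w"
    using assms by (auto simp: parabolic_def)
  then show ?thesis
    unfolding parabolic_def
    by (intro image_eqI[of _ _ "a @ b"]) (simp_all add: wprod_append lists_parabolic_gens)
qed

lemma parabolic_inv:
  assumes "w \<in> parabolic I"
  shows "inv w \<in> parabolic I"
proof -
  obtain a where "a \<in> lists I" "wprod a = w"
    using assms by (auto simp: parabolic_def)
  then show ?thesis
    unfolding parabolic_def
    by (intro image_eqI[of _ _ "rev a"]) (simp_all add: wprod_rev lists_parabolic_gens)
qed

text \<open>Deletion introduces no new letters, so a word that is shortest over all of
  \<open>S\<close> can be reached inside \<open>I\<close>.\<close>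

lemma parabolic_reduced:
  assumes "w \<in> parabolic I"
  obtains u where "u \<in> lists I" "reduced u" "wprod u = w"
proof -
  have "\<exists>v\<in>lists I. reduced v \<and> wprod v = wprod u" if "u \<in> lists I" for u
    using that
  proof (induction u)
    case Nil
    then show ?case by (intro bexI[of _ "[]"]) (simp_all add: reduced_def)
  next
    case (Cons s u)
    then obtain v where v: "v \<in> lists I" "reduced v" "wprod v = wprod u" by blast
    have s: "s \<in> I" "s \<in> S" using Cons I by auto
    have vS: "v \<in> lists S" using v lists_parabolic_gens by blast
    show ?case
    proof (cases "len (wprod v) < len (s \<otimes> wprod v)")
      case True
      then show ?thesis
        using v s by (intro bexI[of _ "s # v"]) (simp_all add: reduced_ConsI)
    next
      case False
      then have "refl_parity v s"
        using gen_parity_cases(2)[OF s(2) vS] by blast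
      then obtain a x b where ab: "v = a @ x # b" "s \<otimes> wprod v = wprod (a @ b)"
        using refl_parity_deletion[OF vS gen_closed[OF s(2)]] by metis
      have abI: "a @ b \<in> lists I" using v(1) ab(1) by simp
      have "len (wprod v) = length v" using v(2) by (simp add: reduced_def)
      then have "length (a @ b) = len (wprod (a @ b))"
        using len_gen_mult[OF s(2) wprod_closed[OF vS]] False ab by auto
      then show ?thesis
        using abI ab(2) v(3) s by (intro bexI[of _ "a @ b"]) (simp_all add: reduced_def lists_parabolic_gens)
    qed
  qed
  then show thesis using assms that by (auto simp: parabolic_def)
qed

text \<open>Build \<open>v\<close> letter by letter. By the cocycle rule the parity of
  \<open>s\<close> in \<open>a @ ub\<close> combines that in \<open>a\<close>, even as
  \<open>s # a\<close> is reduced, with that of the reflection \<open>g\<close> in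
  \<open>ub\<close>, even as \<open>g \<otimes> u\<close> is not shorter than \<open>u\<close>. So
  each new letter adds to the length.\<close>

lemma len_mult_coset_min:
  assumes u: "u \<in> carrier W" and min: "\<And>v. v \<in> parabolic I \<Longrightarrow> len u \<le> len (v \<otimes> u)"
    and v: "v \<in> parabolic I"
  shows "len (v \<otimes> u) = len v + len u"
proof -
  obtain ub where ub: "reduced ub" "wprod ub = u" using reduced_exists[OF u] .
  have main: "reduced a \<Longrightarrow> len (wprod a \<otimes> u) = length a + len u" if "a \<in> lists I" for a
    using that
  proof (induction a)
    case (Cons s a)
    have s: "s \<in> S" "s \<in> I" and a: "reduced a" "a \<in> lists I" "a \<in> lists S"
      using Cons I reduced_ConsD lists_parabolic_gens by auto
    have IH: "len (wprod a \<otimes> u) = length a + len u" using Cons a by blast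
    have word: "a @ ub \<in> lists S" "wprod (a @ ub) = wprod a \<otimes> u"
      using a ub by (simp_all add: wprod_append reduced_lists)
    define g where "g = inv (wprod a) \<otimes> s \<otimes> wprod a"
    have g: "g \<in> parabolic I" "g \<in> carrier W"
    proof -
      have "wprod a \<in> parabolic I" using a by (simp add: parabolic_def)
      then show "g \<in> parabolic I"
        unfolding g_def by (intro parabolic_mult parabolic_inv parabolic_gen[OF s(2)])
      then show "g \<in> carrier W" by (rule parabolic_carrier)
    qed
    have "\<not> refl_parity a s"
    proof
      assume "refl_parity a s"
      then have "len (s \<otimes> wprod a) < len (wprod a)"
        using gen_parity_cases(1) s a by blast
      then show False
        using Cons.prems a(1) by (simp add: reduced_def)
    qed
    moreover have "\<not> refl_parity ub g"
    proof
      assume "refl_parity ub g"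
      then have "len (g \<otimes> u) < len u"
        using refl_parity_len_less[OF reduced_lists[OF ub(1)] g(2)] ub(2) by simp
      then show False using min[OF g(1)] by simp
    qed
    ultimately have "\<not> refl_parity (a @ ub) s"
      using a ub s by (simp add: refl_parity_append reduced_lists g_def)
    then have "len (wprod a \<otimes> u) < len (s \<otimes> (wprod a \<otimes> u))"
      using gen_parity_cases(2)[OF s(1) word(1)] word(2) by simp
    then show ?case
      using len_gen_mult[OF s(1), of "wprod a \<otimes> u"] IH a u s by (auto simp: m_assoc)
  qed (use u in simp)
  obtain a where a: "a \<in> lists I" "reduced a" "wprod a = v"
    using parabolic_reduced[OF v] .
  from main[OF a(1,2)] show ?thesis using a by (simp add: reduced_def)
qed

text \<open>A local minimum is global: with \<open>v0 \<otimes> u\<close> shortest in the coset,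
  lengths add in \<open>u = inv v0 \<otimes> (v0 \<otimes> u)\<close>, and for nontrivial
  \<open>v0\<close> the first letter of a reduced word of \<open>inv v0\<close> would shorten
  \<open>u\<close>.\<close>

lemma left_min_len_mult:
  assumes u: "u \<in> carrier W" "left_min I u" and v: "v \<in> parabolic I"
  shows "len (v \<otimes> u) = len v + len u"
proof (rule len_mult_coset_min[OF u(1) _ v])
  fix v assume "v \<in> parabolic I"
  obtain v0 where v0: "v0 \<in> parabolic I" and min: "\<And>v. v \<in> parabolic I \<Longrightarrow> len (v0 \<otimes> u) \<le> len (v \<otimes> u)"
    using ex_has_least_nat[of "\<lambda>v. v \<in> parabolic I" \<one> "\<lambda>v. len (v \<otimes> u)"] by auto
  have v0c: "v0 \<in> carrier W" using v0 parabolic_carrier by blast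
  have add: "len (x \<otimes> (v0 \<otimes> u)) = len x + len (v0 \<otimes> u)" if "x \<in> parabolic I" for x
  proof (rule len_mult_coset_min[OF _ _ that])
    fix y assume y: "y \<in> parabolic I"
    then have "len (v0 \<otimes> u) \<le> len (y \<otimes> v0 \<otimes> u)"
      using min v0 parabolic_mult by blast
    then show "len (v0 \<otimes> u) \<le> len (y \<otimes> (v0 \<otimes> u))"
      using y v0c u parabolic_carrier by (simp add: m_assoc)
  qed (use v0c u in simp)
  have inv_v0: "inv v0 \<in> parabolic I" using parabolic_inv v0 by blast
  have u_eq: "inv v0 \<otimes> (v0 \<otimes> u) = u" using v0c u by (simp flip: m_assoc)
  obtain a where a: "a \<in> lists I" "reduced a" "wprod a = inv v0"
    using parabolic_reduced[OF inv_v0] .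
  have "v0 = \<one>"
  proof (cases a)
    case Nil
    then show ?thesis using a v0c by (metis inv_inv inv_one wprod_Nil)
  next
    case (Cons s b)
    have s: "s \<in> I" "s \<in> S" and b: "b \<in> lists I" "b \<in> lists S"
      using a Cons I lists_parabolic_gens by auto
    have "s \<otimes> u = wprod b \<otimes> (v0 \<otimes> u)"
    proof -
      have "u = s \<otimes> wprod b \<otimes> (v0 \<otimes> u)"
        using u_eq a(3) Cons by simp
      also have "\<dots> = s \<otimes> (wprod b \<otimes> (v0 \<otimes> u))"
        using s b v0c u by (simp add: m_assoc)
      finally show ?thesis using s b v0c u by (metis gen_cancel m_closed wprod_closed)
    qed
    then have "len (s \<otimes> u) = len (wprod b) + len (v0 \<otimes> u)"
      using add[of "wprod b"] b by (simp add: parabolic_def)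
    moreover have "len u = len (inv v0) + len (v0 \<otimes> u)"
      using add[OF inv_v0] u_eq by simp
    moreover have "len (wprod b) < len (inv v0)"
      using a Cons len_le[OF b(2)] by (auto simp: reduced_def)
    ultimately show ?thesis
      using u(2) s by (auto simp: left_min_def)
  qed
  then show "len u \<le> len (v \<otimes> u)"
    using min[OF \<open>v \<in> parabolic I\<close>] u by simp
qed

lemma left_min_exists:
  assumes w: "w \<in> carrier W"
  obtains v where "v \<in> parabolic I" "left_min I (v \<otimes> w)"
proof -
  obtain v where v: "v \<in> parabolic I" and min: "\<And>x. x \<in> parabolic I \<Longrightarrow> len (v \<otimes> w) \<le> len (x \<otimes> w)"
    using ex_has_least_nat[of "\<lambda>v. v \<in> parabolic I" \<one> "\<lambda>v. len (v \<otimes> w)"] by auto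
  have vc: "v \<in> carrier W" using v parabolic_carrier by blast
  have "len (v \<otimes> w) < len (s \<otimes> (v \<otimes> w))" if s: "s \<in> I" for s
  proof -
    have "len (v \<otimes> w) \<le> len (s \<otimes> v \<otimes> w)"
      using min parabolic_mult[OF parabolic_gen[OF s] v] by blast
    then show ?thesis
      using len_gen_mult[of s "v \<otimes> w"] s I vc w by (auto simp: m_assoc)
  qed
  then show thesis using that[OF v] by (simp add: left_min_def)
qed

text \<open>The mirror image of \<open>len_mult_coset_min\<close>: the parity of \<open>s\<close> is
  odd in the whole word and even in \<open>a\<close>, hence odd in the remaining factor, which the
  next letter therefore shortens.\<close>

lemma left_descents_longest:
  assumes w: "w \<in> carrier W" and desc: "\<And>s. s \<in> I \<Longrightarrow> len (s \<otimes> w) < len w" and v: "v \<in> parabolic I"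
  shows "len w = len v + len (inv v \<otimes> w)"
proof -
  have main: "reduced a \<Longrightarrow> len w = length a + len (inv (wprod a) \<otimes> w)" if "a \<in> lists I" for a
    using that
  proof (induction a)
    case (Cons s a)
    have s: "s \<in> S" "s \<in> I" and a: "reduced a" "a \<in> lists S"
      using Cons I reduced_ConsD lists_parabolic_gens by auto
    define y where "y = inv (wprod a) \<otimes> w"
    have y: "y \<in> carrier W" "w = wprod a \<otimes> y"
      using a w by (simp_all add: y_def flip: m_assoc)
    have IH: "len w = length a + len y" using Cons a by (simp add: y_def)
    obtain yb where yb: "reduced yb" "wprod yb = y" using reduced_exists[OF y(1)] .
    define g where "g = inv (wprod a) \<otimes> s \<otimes> wprod a"
    have g: "g \<in> carrier W" using a s by (simp add: g_def)
    have gy: "g \<otimes> y = inv (wprod (s # a)) \<otimes> w"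
      using a s y by (simp add: g_def inv_mult_group m_assoc)
    have "\<not> refl_parity a s"
    proof
      assume "refl_parity a s"
      then have "len (s \<otimes> wprod a) < len (wprod a)"
        using gen_parity_cases(1) s a by blast
      then show False
        using Cons.prems a(1) by (simp add: reduced_def)
    qed
    moreover have "refl_parity (a @ yb) s"
      using gen_parity_cases(1)[OF s(1), of "a @ yb"] desc[OF s(2)] a yb y
      by (simp add: wprod_append reduced_lists)
    ultimately have "refl_parity yb g"
      using a yb s by (simp add: refl_parity_append reduced_lists g_def)
    then have "len (g \<otimes> y) < len y"
      using refl_parity_len_less[OF reduced_lists[OF yb(1)] g] yb by simp
    moreover have "len w \<le> Suc (length a) + len (g \<otimes> y)"
    proof -
      have "wprod (s # a) \<in> carrier W" using a s by simp
      then have "wprod (s # a) \<otimes> (g \<otimes> y) = w"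
        unfolding gy using w by (simp del: wprod_Cons flip: m_assoc)
      moreover have "len (wprod (s # a)) = Suc (length a)"
        using Cons.prems by (simp add: reduced_def)
      ultimately show ?thesis
        using len_mult_le[of "wprod (s # a)" "g \<otimes> y"] a s g y by simp
    qed
    ultimately show ?case using IH gy by simp
  qed (use w in simp)
  obtain a where a: "a \<in> lists I" "reduced a" "wprod a = v"
    using parabolic_reduced[OF v] .
  from main[OF a(1,2)] show ?thesis using a by (simp add: reduced_def)
qed

lemma longest_unique:
  assumes v: "v \<in> parabolic I" "\<And>s. s \<in> I \<Longrightarrow> len (s \<otimes> v) < len v"
    and w: "w \<in> parabolic I" "\<And>s. s \<in> I \<Longrightarrow> len (s \<otimes> w) < len w"
  shows "v = w"
proof -
  have c: "v \<in> carrier W" "w \<in> carrier W" using v w parabolic_carrier by auto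
  have "len w = len v + len (inv v \<otimes> w)" "len v = len w + len (inv w \<otimes> v)"
    using left_descents_longest[OF c(2) w(2) v(1)] left_descents_longest[OF c(1) v(2) w(1)] by auto
  then have "len (inv v \<otimes> w) = 0" by linarith
  then have "inv v \<otimes> w = \<one>" using c len_eq_0 by simp
  then show ?thesis using c by (metis inv_solve_left inv_closed r_one one_closed)
qed

lemma left_descent_iff:
  assumes "s \<in> I" "w \<in> carrier W"
  shows "\<not> len w < len (s \<otimes> w) \<longleftrightarrow> len (s \<otimes> w) < len w"
proof -
  have "s \<in> S" using assms(1) I by blast
  from len_gen_mult[OF this assms(2)] show ?thesis by (elim disjE) simp_all
qed

lemma longest_exists:
  assumes "finite (carrier W)"
  shows "\<exists>w\<in>parabolic I. \<forall>s\<in>I. len (s \<otimes> w) < len w"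
proof -
  have "parabolic I \<subseteq> carrier W" using parabolic_carrier by blast
  then have fin: "finite (len ` parabolic I)"
    using assms by (intro finite_imageI) (rule finite_subset)
  then have "Max (len ` parabolic I) \<in> len ` parabolic I"
    by (intro Max_in) (use parabolic_one in blast)+
  then obtain w where w: "w \<in> parabolic I" "len w = Max (len ` parabolic I)" by auto
  have "len (s \<otimes> w) < len w" if s: "s \<in> I" for s
  proof -
    have "len (s \<otimes> w) \<le> len w"
      unfolding w(2) using fin parabolic_mult[OF parabolic_gen[OF s] w(1)] by simp
    then show ?thesis
      using left_descent_iff[OF s parabolic_carrier[OF w(1)]] by simp
  qed
  then show ?thesis using w(1) by blast
qed

text \<open>After exchanging the sums, \<open>w\<close> is weighted by the alternating sum over
  subsets of its left ascents \<open>A w\<close>, which vanishes unless \<open>w\<close> is the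
  longest element; \<open>n\<close> is the length of the latter. The sums over
  \<open>left_min\<close> elements stand for quotients of Poincare polynomials.\<close>

lemma alternating_parabolic_sum:
  fixes z :: "'k::comm_ring_1"
  assumes fin: "finite (carrier W)"
  shows "\<exists>n. (n = 0 \<longrightarrow> I = {}) \<and>
    (\<Sum>J\<in>Pow I. (- 1) ^ card J * (\<Sum>w | w \<in> parabolic I \<and> left_min J w. z ^ len w)) = z ^ n"
proof -
  have finP: "finite (parabolic I)" and finI: "finite I"
    using fin parabolic_carrier I gens_closed by (meson finite_subset subsetI)+
  obtain w0 where w0: "w0 \<in> parabolic I" "\<And>s. s \<in> I \<Longrightarrow> len (s \<otimes> w0) < len w0"
    using longest_exists[OF fin] by blast
  define A where "A w = {s \<in> I. len w < len (s \<otimes> w)}" for w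
  have A_empty: "A w = {} \<longleftrightarrow> w = w0" if w: "w \<in> parabolic I" for w
  proof
    assume "A w = {}"
    then have "len (s \<otimes> w) < len w" if "s \<in> I" for s
      using that left_descent_iff[OF that parabolic_carrier[OF w]] by (auto simp: A_def)
    then show "w = w0" using longest_unique[OF w _ w0] by blast
  next
    assume "w = w0"
    then show "A w = {}" using w0(2) by (auto simp: A_def dest: less_asym)
  qed
  have "(\<Sum>J\<in>Pow I. (- 1) ^ card J * (\<Sum>w | w \<in> parabolic I \<and> left_min J w. z ^ len w))
    = (\<Sum>J\<in>Pow I. \<Sum>w\<in>parabolic I. if left_min J w then (- 1) ^ card J * z ^ len w else 0)"
    using finP by (intro sum.cong refl) (auto simp: sum_distrib_left sum.inter_filter intro!: sum.cong)
  also have "\<dots> = (\<Sum>w\<in>parabolic I. \<Sum>J\<in>Pow I. if left_min J w then (- 1) ^ card J * z ^ len w else 0)"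
    by (rule sum.swap)
  also have "\<dots> = (\<Sum>w\<in>parabolic I. (\<Sum>J\<in>Pow (A w). (- 1) ^ card J) * z ^ len w)"
  proof (intro sum.cong refl)
    fix w
    have "{J \<in> Pow I. left_min J w} = Pow (A w)"
      by (auto simp: left_min_def A_def)
    then show "(\<Sum>J\<in>Pow I. if left_min J w then (- 1) ^ card J * z ^ len w else 0)
      = (\<Sum>J\<in>Pow (A w). (- 1) ^ card J) * z ^ len w"
      using finI by (simp add: sum_distrib_right sum.inter_filter[symmetric])
  qed
  also have "\<dots> = (\<Sum>w\<in>parabolic I. of_bool (w = w0) * z ^ len w)"
  proof (intro sum.cong refl)
    fix w assume "w \<in> parabolic I"
    moreover have "finite (A w)" using finI by (simp add: A_def)
    ultimately show "(\<Sum>J\<in>Pow (A w). (- 1) ^ card J) * z ^ len w = of_bool (w = w0) * z ^ len w"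
      by (simp add: sum_Pow_alternating A_empty)
  qed
  also have "\<dots> = z ^ len w0"
  proof -
    have "(\<Sum>w\<in>parabolic I. of_bool (w = w0) * z ^ len w) = (\<Sum>w\<in>parabolic I. if w = w0 then z ^ len w else 0)"
      by (intro sum.cong refl) simp
    then show ?thesis using finP w0(1) by (simp add: sum.delta)
  qed
  finally have "(\<Sum>J\<in>Pow I. (- 1) ^ card J * (\<Sum>w | w \<in> parabolic I \<and> left_min J w. z ^ len w)) = z ^ len w0" .
  moreover have "I = {}" if "len w0 = 0"
  proof (rule ccontr)
    assume "I \<noteq> {}"
    then obtain s where "s \<in> I" by blast
    from w0(2)[OF this] that show False by simp
  qed
  ultimately show ?thesis by (intro exI[of _ "len w0"]) simp
qed

end

section \<open>Coset factorization and the roots of Poincare polynomials\<close>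

lemma parabolic_factorization:
  fixes z :: "'k::comm_ring_1"
  assumes J: "J \<subseteq> I" and I: "I \<subseteq> S"
  shows "(\<Sum>w\<in>parabolic I. z ^ len w) =
    (\<Sum>v\<in>parabolic J. z ^ len v) * (\<Sum>u | u \<in> parabolic I \<and> left_min J u. z ^ len u)"
proof -
  have JS: "J \<subseteq> S" using J I by simp
  let ?M = "{u \<in> parabolic I. left_min J u}"
  note c = parabolic_carrier[OF I] parabolic_carrier[OF JS]
  have sub: "v \<in> parabolic I" if "v \<in> parabolic J" for v
    using that parabolic_mono[OF J] by blast
  have add: "len (v \<otimes> u) = len v + len u" if "v \<in> parabolic J" "u \<in> ?M" for v u
    using left_min_len_mult[OF JS] c that by blast
  have inj: "inj_on (\<lambda>(v, u). v \<otimes> u) (parabolic J \<times> ?M)"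
  proof (rule inj_onI, clarify)
    fix v u v' u'
    assume v: "v \<in> parabolic J" "v' \<in> parabolic J" and u: "u \<in> parabolic I" "left_min J u"
      "u' \<in> parabolic I" "left_min J u'" and eq: "v \<otimes> u = v' \<otimes> u'"
    have cc: "v \<in> carrier W" "v' \<in> carrier W" "u \<in> carrier W" "u' \<in> carrier W"
      using v u c by auto
    define x where "x = inv v' \<otimes> v"
    have x: "x \<in> parabolic J" "x \<in> carrier W"
      using v parabolic_inv[OF JS] parabolic_mult[OF JS] cc by (auto simp: x_def)
    have "u' = inv v' \<otimes> (v' \<otimes> u')"
      using cc by (simp flip: m_assoc)
    then have u': "u' = x \<otimes> u"
      unfolding eq[symmetric] x_def using cc by (simp add: m_assoc)
    then have "u = inv x \<otimes> u'"
      using cc x by (simp flip: m_assoc)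
    \<comment> \<open>Lengths add in both directions between \<open>u\<close> and \<open>u'\<close>,
      which leaves length 0 for \<open>x\<close>.\<close>
    then have "len u = len (inv x) + len u'"
      using add[of "inv x" u'] parabolic_inv[OF JS x(1)] u by simp
    moreover have "len u' = len x + len u"
      using add[of x u] x u u' by simp
    ultimately have "x = \<one>"
      using len_eq_0 x by simp
    then have "u' = u" using u' cc by simp
    then show "v = v' \<and> u = u'"
      using eq cc by simp
  qed
  have img: "(\<lambda>(v, u). v \<otimes> u) ` (parabolic J \<times> ?M) = parabolic I"
  proof (intro equalityI subsetI)
    fix w assume "w \<in> (\<lambda>(v, u). v \<otimes> u) ` (parabolic J \<times> ?M)"
    then show "w \<in> parabolic I" using parabolic_mult[OF I] sub by auto
  next
    fix w assume w: "w \<in> parabolic I"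
    obtain v where v: "v \<in> parabolic J" "left_min J (v \<otimes> w)"
      using left_min_exists[OF JS c(1)[OF w]] .
    have "w = inv v \<otimes> (v \<otimes> w)"
      using c v w by (simp flip: m_assoc)
    moreover have "inv v \<in> parabolic J" "v \<otimes> w \<in> ?M"
      using v w parabolic_inv[OF JS] parabolic_mult[OF I] sub by auto
    ultimately show "w \<in> (\<lambda>(v, u). v \<otimes> u) ` (parabolic J \<times> ?M)" by force
  qed
  have "(\<Sum>w\<in>parabolic I. z ^ len w) = (\<Sum>(v, u)\<in>parabolic J \<times> ?M. z ^ len (v \<otimes> u))"
    using sum.reindex[OF inj, of "\<lambda>w. z ^ len w"] unfolding img by (simp add: case_prod_unfold)
  also have "\<dots> = (\<Sum>(v, u)\<in>parabolic J \<times> ?M. z ^ len v * z ^ len u)"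
    using add by (intro sum.cong refl) (auto simp: power_add)
  finally show ?thesis
    by (simp add: sum_product sum.cartesian_product)
qed

text \<open>At a zero with \<open>norm z \<noteq> 1\<close>, induction makes the sums of proper
  subsets nonzero, so the factorization kills every term of the alternating sum but
  \<open>J = I\<close>. What remains is \<open>z ^ n = (- 1) ^ card I\<close> with
  \<open>n > 0\<close>, which forces norm 1.\<close>

theorem parabolic_root_norm:
  fixes z :: complex
  assumes fin: "finite (carrier W)" and "I \<subseteq> S" "(\<Sum>w\<in>parabolic I. z ^ len w) = 0"
  shows "norm z = 1"
proof -
  have "finite I" using fin assms(2) gens_closed by (meson finite_subset)
  then show ?thesis using assms(2,3)
  proof (induction I rule: finite_psubset_induct)
    case (psubset I)
    let ?P = "\<lambda>J. \<Sum>w | w \<in> parabolic I \<and> left_min J w. z ^ len w"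
    show ?case
    proof (rule ccontr)
      assume norm: "norm z \<noteq> 1"
      have zero: "?P J = 0" if "J \<subset> I" for J
      proof -
        have "(\<Sum>w\<in>parabolic J. z ^ len w) \<noteq> 0"
          using psubset.IH[OF that] psubset.prems(1) that norm by blast
        then show ?thesis
          using parabolic_factorization[of J I z] psubset.prems that by auto
      qed
      have "{w \<in> parabolic I. left_min I w} = {\<one>}"
      proof (intro equalityI subsetI)
        fix w assume "w \<in> {w \<in> parabolic I. left_min I w}"
        then have w: "w \<in> parabolic I" "left_min I w" by auto
        have wc: "w \<in> carrier W" using w parabolic_carrier[OF psubset.prems(1)] by blast
        have "len (inv w \<otimes> w) = len (inv w) + len w"
          using left_min_len_mult[OF psubset.prems(1) wc w(2)] parabolic_inv[OF psubset.prems(1) w(1)] by blast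
        then show "w \<in> {\<one>}" using wc len_eq_0 by simp
      next
        fix w assume "w \<in> {\<one>}"
        moreover have "len (s \<otimes> \<one>) \<noteq> 0" if "s \<in> I" for s
          using len_gen_mult[of s \<one>] that psubset.prems(1) by auto
        ultimately show "w \<in> {w \<in> parabolic I. left_min I w}" by (simp add: left_min_def)
      qed
      then have one: "?P I = 1" by simp
      obtain n where n: "n = 0 \<longrightarrow> I = {}" "(\<Sum>J\<in>Pow I. (- 1) ^ card J * ?P J) = z ^ n"
        using alternating_parabolic_sum[OF psubset.prems(1) fin, of z] by (elim exE conjE)
      have "(\<Sum>J\<in>Pow I. (- 1) ^ card J * ?P J) = (\<Sum>J\<in>{I}. (- 1) ^ card J * ?P J)"
        using psubset.hyps zero by (intro sum.mono_neutral_right) auto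
      then have "z ^ n = (- 1) ^ card I" using n(2) one by simp
      then have "norm z ^ n = 1" by (metis norm_minus_cancel norm_one norm_power power_one)
      moreover have "I \<noteq> {}" using psubset.prems(2) by (auto simp: parabolic_empty)
      ultimately show False
        using norm n(1) power_eq_imp_eq_base[of "norm z" n 1] by simp
    qed
  qed
qed

end

section \<open>Palindromic polynomials\<close>

lemma map_poly_cnj_mult: "map_poly cnj (p * q) = map_poly cnj p * map_poly cnj q"
  by (rule poly_eqI) (simp add: coeff_map_poly coeff_mult)

text \<open>For \<open>\<alpha>\<close> on the unit circle, the reversal
  \<open>1 - \<alpha> X\<close> of \<open>X - \<alpha>\<close> is \<open>- \<alpha>\<close> times
  \<open>X - cnj \<alpha>\<close>; reversal and conjugation are multiplicative, so roots can be
  split off one by one.\<close>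

lemma reflect_poly_unit_circle:
  fixes p :: "complex poly"
  assumes "p \<noteq> 0" "\<And>z. poly p z = 0 \<Longrightarrow> norm z = 1"
  shows "\<exists>c. reflect_poly p = smult c (map_poly cnj p)"
  using assms
proof (induction "degree p" arbitrary: p)
  case 0
  then obtain a where p: "p = [:a:]"
    by (metis degree_eq_zeroE)
  then have "reflect_poly p = smult (a / cnj a) (map_poly cnj p)"
    using 0 by (simp add: map_poly_pCons)
  then show ?case ..
next
  case (Suc n)
  have "\<not> constant (poly p)"
    using Suc.hyps(2) by (simp add: constant_degree)
  then obtain \<alpha> where \<alpha>: "poly p \<alpha> = 0"
    using fundamental_theorem_of_algebra by blast
  then obtain q where q: "p = [:- \<alpha>, 1:] * q"
    by (auto simp: poly_eq_0_iff_dvd)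
  have q0: "q \<noteq> 0" using Suc.prems(1) q by auto
  have "degree p = Suc (degree q)"
    unfolding q using q0 by (subst degree_mult_eq) auto
  moreover have "norm z = 1" if "poly q z = 0" for z
    using Suc.prems(2)[of z] that q by simp
  ultimately obtain c where c: "reflect_poly q = smult c (map_poly cnj q)"
    using Suc.hyps q0 by auto
  have "\<alpha> * cnj \<alpha> = 1"
    using Suc.prems(2)[OF \<alpha>] by (simp flip: complex_norm_square)
  moreover from this have "\<alpha> \<noteq> 0" by auto
  ultimately have "reflect_poly [:- \<alpha>, 1:] = smult (- \<alpha>) (map_poly cnj [:- \<alpha>, 1:])"
    by (simp add: reflect_poly_pCons map_poly_pCons)
  then have "reflect_poly p = smult (- \<alpha> * c) (map_poly cnj p)"
    unfolding q reflect_poly_mult map_poly_cnj_mult c by (simp add: ac_simps)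
  then show ?case ..
qed

lemma reflect_poly_eq_self:
  fixes p :: "complex poly"
  assumes "map_poly cnj p = p" "poly p 1 \<noteq> 0" "\<And>z. poly p z = 0 \<Longrightarrow> norm z = 1"
  shows "reflect_poly p = p"
proof -
  have "p \<noteq> 0" using assms(2) by auto
  then obtain c where c: "reflect_poly p = smult c p"
    using reflect_poly_unit_circle[of p] assms(1,3) by auto
  \<comment> \<open>Reversal keeps the value at 1, which pins the constant \<open>c\<close> to
    1.\<close>
  moreover have "poly (reflect_poly p) 1 = poly p 1"
    by (simp add: poly_reflect_poly_nz)
  ultimately show ?thesis using assms(2) by simp
qed

text \<open>With \<open>g\<close> arbitrary, the symmetry of coefficients found over the complex
  numbers can be used for powers in another ring.\<close>

lemma sum_palindromic:
  fixes h :: "'x \<Rightarrow> nat" and g :: "nat \<Rightarrow> 'k::semiring_1"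
  assumes fin: "finite X" and ne: "X \<noteq> {}"
    and roots: "\<And>z::complex. (\<Sum>x\<in>X. z ^ h x) = 0 \<Longrightarrow> norm z = 1"
  shows "(\<Sum>x\<in>X. g (Max (h ` X) - h x)) = (\<Sum>x\<in>X. g (h x))"
proof -
  define M where "M = Max (h ` X)"
  define c where "c i = card {x \<in> X. h x = i}" for i
  define p where "p = (\<Sum>x\<in>X. monom (1::complex) (h x))"
  have le: "h x \<le> M" if "x \<in> X" for x
    using fin that by (simp add: M_def)
  have coeff: "coeff p i = of_nat (c i)" for i
    using fin by (simp add: p_def coeff_sum c_def sum.If_cases Int_def)
  have "M \<in> h ` X" using fin ne by (simp add: M_def)
  then have "{x \<in> X. h x = M} \<noteq> {}" by auto
  then have "c M \<noteq> 0" using fin by (simp add: c_def)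
  moreover have "c i = 0" if "i > M" for i
    using that by (auto simp: c_def card_eq_0_iff dest!: le)
  ultimately have deg: "degree p = M"
    by (intro antisym degree_le le_degree) (auto simp: coeff)
  have poly_p: "poly p z = (\<Sum>x\<in>X. z ^ h x)" for z
    by (simp add: p_def poly_sum poly_monom)
  have "reflect_poly p = p"
  proof (rule reflect_poly_eq_self)
    show "map_poly cnj p = p" by (rule poly_eqI) (simp add: coeff_map_poly coeff)
    show "poly p 1 \<noteq> 0" using fin ne by (simp add: poly_p)
  qed (use roots in \<open>simp add: poly_p\<close>)
  then have "coeff p (M - i) = coeff p i" if "i \<le> M" for i
    using that coeff_reflect_poly[of p i] by (simp add: deg)
  then have c_sym: "c (M - i) = c i" if "i \<le> M" for i
    using that by (simp add: coeff)
  have "(\<Sum>x\<in>X. g (M - h x)) = (\<Sum>i\<le>M. of_nat (c (M - i)) * g i)"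
  proof -
    have "{x \<in> X. M - h x = i} = {x \<in> X. h x = M - i}" if "i \<le> M" for i
      using le that by force
    then show ?thesis
      using fin by (subst sum_fun_comp[where R = "{..M}"]) (auto simp: c_def)
  qed
  also have "\<dots> = (\<Sum>i\<le>M. of_nat (c i) * g i)"
    by (simp add: c_sym)
  also have "\<dots> = (\<Sum>x\<in>X. g (h x))"
    using fin le by (subst sum_fun_comp[where R = "{..M}"]) (auto simp: c_def)
  finally show ?thesis by (simp add: M_def)
qed

theorem corollary8p2:
  fixes W (structure) and S H and m :: int and q :: "rat fls"
  assumes "quasiparabolic_subgroup W S H"
    and "finite (carrier W)"
    and "m = Max (coxeter_system.coset_height W S ` (lcosets H))"
    and "q = fls_X"
  shows "q powi m *
           poincare_series (coxeter_system.coset_height W S) (lcosets H) (inverse q)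
         = poincare_series (coxeter_system.coset_height W S) (lcosets H) q"
proof -
  interpret quasiparabolic_subgroup W S H by fact
  interpret quasiparabolic_set W S "lcosets H" "coset_action W H" coset_height
    by (rule quasiparabolic)
  let ?X = "lcosets H"
  define h where "h C = (INF v\<in>C. len v)" for C
  have ht: "coset_height C = int (h C)" for C
    by (simp add: coset_height_def h_def)
  have H: "H \<in> ?X" "h H = 0"
  proof -
    have "\<one> <# H = H"
      using subgroup.subset[OF subgroup_H] by (rule lcos_mult_one)
    then show "H \<in> ?X" by (auto simp: LCOSETS_def)
    have "0 \<in> len ` H"
      using subgroup.one_closed[OF subgroup_H] by (intro image_eqI[of _ _ \<one>]) simp_all
    then show "h H = 0" using wellorder_Inf_le1[of 0 "len ` H"] by (simp add: h_def)
  qed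
  have transitive: "\<exists>w\<in>carrier W. coset_action W H w H = C" if "C \<in> ?X" for C
    using that H(1) by (auto simp: coset_action_def LCOSETS_def)
  have fin: "finite ?X"
  proof -
    have "?X \<subseteq> (\<lambda>w. coset_action W H w H) ` carrier W" using transitive by blast
    then show ?thesis using assms(2) finite_surj by blast
  qed
  have roots: "norm z = 1" if "(\<Sum>C\<in>?X. z ^ h C) = 0" for z :: complex
  proof (rule parabolic_root_norm[OF assms(2) subset_refl])
    have "(\<Sum>C\<in>?X. z ^ nat (coset_height C)) dvd (\<Sum>w\<in>carrier W. z ^ len w)"
      by (rule poincare_dvd[OF assms(2) _ H(1) _ transitive]) (simp_all add: ht H)
    then show "(\<Sum>w\<in>parabolic S. z ^ len w) = 0"
      using that by (simp add: ht parabolic_gens)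
  qed
  define M where "M = Max (h ` ?X)"
  have m: "m = int M"
    unfolding assms(3) M_def
    using fin H(1) by (subst mono_Max_commute[of int]) (auto simp: ht image_image mono_def)
  have "q \<noteq> 0" using assms(4) by simp
  have "q powi m * inverse q powi coset_height C = q ^ (M - h C)" if "C \<in> ?X" for C
  proof -
    have "h C \<le> M" using fin that by (simp add: M_def)
    then have "q ^ M = q ^ (M - h C) * q ^ h C" by (simp flip: power_add)
    then show ?thesis using \<open>q \<noteq> 0\<close> by (simp add: m ht field_simps)
  qed
  then have "q powi m * poincare_series coset_height ?X (inverse q) = (\<Sum>C\<in>?X. q ^ (M - h C))"
    by (simp add: poincare_series_def sum_distrib_left)
  also have "\<dots> = (\<Sum>C\<in>?X. q ^ h C)"
    unfolding M_def using sum_palindromic[of ?X h "\<lambda>n. q ^ n"] fin H(1) roots by blast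
  also have "\<dots> = poincare_series coset_height ?X q"
    by (simp add: poincare_series_def ht)
  finally show ?thesis .
qed

end
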